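(* Let $\Phi$ be a holomorphic map from the unit ball $B^n$ of $\mathbb{C}^n$ into $\mathbb{C}^m$ whose components are polynomials of total degree at most $s$, none of which vanishes at $\boldsymbol{1}$. If $F$ is another holomorphic map from $B^n$ into $\mathbb{C}^m$ such that $|F(\boldsymbol{z})|\leq|\Phi(\boldsymbol{z})|$ for all $\boldsymbol{z}\in\partial B^n\cap B^n_\varepsilon(\boldsymbol{1})$ for some $\varepsilon>0$, and $$F(\boldsymbol{z})=\Phi(\boldsymbol{z})+o\left(|\boldsymbol{z}-\boldsymbol{1}|^{2s+1}\right)\quad\text{as } B^n\ni\boldsymbol{z}\rightarrow\boldsymbol{1},$$ then $F\equiv\Phi$ on $B^n$.
   Context: $B^n$ is the open unit ball of $\mathbb{C}^n$, $\partial B^n$ is the unit sphere, and $B^n_r(\boldsymbol{\tau})$ is the ball of radius $r>0$ around $\boldsymbol{\tau}\in\mathbb{C}^n$. The point $\boldsymbol{1}$ is $(1,0,\ldots,0)\in\partial B^n$. $|\cdot|$ denotes the norm on $\mathbb{C}^k$ (for any dimension $k$) associated with the standard Hermitian inner product. The inequality $|F|\leq|\Phi|$ on part of $\partial B^n$ refers to boundary values of $F$ and $\Phi$.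
   Formalization: The formal theorem assumes n ≥ 2; for n = 1 the claim is false (s = 0, m = 1, Φ = 1, F(z) = 1 + (z−1)² satisfies every hypothesis with ε = 1). Boundary values of F are taken as radial limits. *)

theory Defs
  imports "HOL-Analysis.Analysis"
begin

text \<open>
  Complex \<open>n\<close>-space is \<open>complex ^ 'n\<close>; its norm is the one of the standard Hermitian product.
  Coordinates are indexed by a finite type without a distinguished first element, so the point
  \<open>(1, 0, \<dots>, 0)\<close> becomes \<open>axis k 1\<close> for an arbitrary index \<open>k\<close>.
\<close>

text \<open>
  A map on an open set is holomorphic iff it is (Frechet) differentiable at every point with
  a complex linear derivative; \<open>has_derivative\<close> itself only requires real linearity.
\<close>
definition holomorphic_map_on :: "(complex ^ 'n \<Rightarrow> complex ^ 'm) \<Rightarrow> (complex ^ 'n) set \<Rightarrow> bool"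
  (infixl \<open>holomorphic'_map'_on\<close> 50) where
  "F holomorphic_map_on S \<longleftrightarrow>
     (\<forall>z\<in>S. \<exists>F'. (F has_derivative F') (at z) \<and> (\<forall>c v. F' (c *s v) = c *s F' v))"

definition poly_total_degree_le :: "nat \<Rightarrow> (complex ^ 'n \<Rightarrow> complex) \<Rightarrow> bool" where
  "poly_total_degree_le s p \<longleftrightarrow>
     (\<exists>c :: ('n \<Rightarrow> nat) \<Rightarrow> complex.
        \<forall>z. p z = (\<Sum>\<alpha> | (\<Sum>i\<in>UNIV. \<alpha> i) \<le> s. c \<alpha> * (\<Prod>i\<in>UNIV. (z $ i) ^ \<alpha> i)))"

text \<open>The sum above is a genuine one: its index set is finite.\<close>
lemma finite_multi_indices: "finite {\<alpha> :: 'n::finite \<Rightarrow> nat. (\<Sum>i\<in>UNIV. \<alpha> i) \<le> s}"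
proof (rule finite_subset)
  show "{\<alpha> :: 'n \<Rightarrow> nat. (\<Sum>i\<in>UNIV. \<alpha> i) \<le> s} \<subseteq> Pi\<^sub>E UNIV (\<lambda>_. {..s})"
  proof
    fix \<alpha> :: "'n \<Rightarrow> nat" assume "\<alpha> \<in> {\<alpha>. (\<Sum>i\<in>UNIV. \<alpha> i) \<le> s}"
    then have "\<alpha> i \<le> s" for i
      using member_le_sum[of i UNIV \<alpha>] by simp
    then show "\<alpha> \<in> Pi\<^sub>E UNIV (\<lambda>_. {..s})" by (simp add: PiE_UNIV_domain)
  qed
  show "finite (Pi\<^sub>E (UNIV :: 'n set) (\<lambda>_. {..s}))"
    by (simp add: finite_PiE)
qed

text \<open>
  Boundary values of a map on the unit ball are radial limits. This is the weakest of the usual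
  notions: if the unrestricted or the nontangential limit at \<open>\<zeta>\<close> exists, so does the radial one.
\<close>
definition has_boundary_value :: "(complex ^ 'n \<Rightarrow> complex ^ 'm) \<Rightarrow> complex ^ 'n \<Rightarrow> complex ^ 'm \<Rightarrow> bool"
  where "has_boundary_value F \<zeta> w \<longleftrightarrow> ((\<lambda>r. F (r *\<^sub>R \<zeta>)) \<longlongrightarrow> w) (at_left (1::real))"

text \<open>
  In dimension one the hypothesis on an arc of the unit circle does not determine \<open>F\<close>: for \<open>s = 0\<close>,
  \<open>\<Phi> = 1\<close> and \<open>F(z) = 1 + (z - 1)\<^sup>2\<close> all hypotheses hold with \<open>\<epsilon> = 1\<close>. Hence the assumption
  \<open>CARD('n) \<ge> 2\<close> in the theorem.
\<close>
lemma dimension_one_counterexample: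
  fixes e :: "complex ^ 1" and \<Phi> F :: "complex ^ 1 \<Rightarrow> complex ^ 1"
  defines "e \<equiv> axis 1 1"
  defines "\<Phi> \<equiv> (\<lambda>_. vec 1)"
  defines "F \<equiv> (\<lambda>z. vec (1 + (z $ 1 - 1)\<^sup>2))"
  shows "\<Phi> holomorphic_map_on ball 0 1"
    and "\<And>j. poly_total_degree_le 0 (\<lambda>z. \<Phi> z $ j)"
    and "\<And>j. \<Phi> e $ j \<noteq> 0"
    and "F holomorphic_map_on ball 0 1"
    and "\<forall>\<zeta>\<in>sphere 0 1 \<inter> ball e 1. \<exists>w. has_boundary_value F \<zeta> w \<and> norm w \<le> norm (\<Phi> \<zeta>)"
    and "(\<lambda>z. norm (F z - \<Phi> z)) \<in> o[at e within ball 0 1](\<lambda>z. norm (z - e) ^ (2 * 0 + 1))"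
    and "\<not> (\<forall>z\<in>ball 0 1. F z = \<Phi> z)"
proof -
  have n1: "norm x = cmod (x $ 1)" for x :: "complex ^ 1"
    by (simp add: norm_vec_def)
  have e1: "e $ 1 = 1" by (simp add: e_def)
  show "\<Phi> holomorphic_map_on ball 0 1"
    unfolding holomorphic_map_on_def \<Phi>_def
    by (intro ballI exI[of _ "\<lambda>_. 0"]) auto
  have "{\<alpha> :: 1 \<Rightarrow> nat. (\<Sum>i\<in>UNIV. \<alpha> i) \<le> 0} = {\<lambda>_. 0}"
    by (auto simp: fun_eq_iff)
  then show "poly_total_degree_le 0 (\<lambda>z. \<Phi> z $ j)" for j
    unfolding poly_total_degree_le_def \<Phi>_def by (intro exI[of _ "\<lambda>_. 1"]) simp
  show "\<Phi> e $ j \<noteq> 0" for j by (simp add: \<Phi>_def)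
  have blv: "bounded_linear (vec :: complex \<Rightarrow> complex ^ 1)"
    by (rule bounded_linear_intro[of _ 1]) (auto simp: vec_eq_iff n1)
  have d: "(F has_derivative (\<lambda>v. vec (2 * (z $ 1 - 1) * v $ 1))) (at z)" for z
    unfolding F_def
    by (rule bounded_linear.has_derivative[OF blv])
       (auto intro!: derivative_eq_intros bounded_linear.has_derivative[OF bounded_linear_vec_nth]
             simp: algebra_simps)
  show "F holomorphic_map_on ball 0 1"
    unfolding holomorphic_map_on_def
  proof
    fix z :: "complex ^ 1"
    show "\<exists>F'. (F has_derivative F') (at z) \<and> (\<forall>c v. F' (c *s v) = c *s F' v)"
      by (rule exI, rule conjI, rule d) (simp add: vec_eq_iff)
  qed
  show "\<forall>\<zeta>\<in>sphere 0 1 \<inter> ball e 1. \<exists>w. has_boundary_value F \<zeta> w \<and> norm w \<le> norm (\<Phi> \<zeta>)"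
  proof
    fix \<zeta> assume z: "\<zeta> \<in> sphere 0 1 \<inter> ball e 1"
    have "isCont F (1 *\<^sub>R \<zeta>)" using d has_derivative_continuous by blast
    moreover have "((\<lambda>r. r *\<^sub>R \<zeta>) \<longlongrightarrow> 1 *\<^sub>R \<zeta>) (at_left (1::real))"
      by (intro tendsto_intros)
    ultimately have b: "has_boundary_value F \<zeta> (F \<zeta>)"
      unfolding has_boundary_value_def using isCont_tendsto_compose by fastforce
    obtain x y where xy: "\<zeta> $ 1 = Complex x y" by (metis complex.exhaust)
    have c: "x\<^sup>2 + y\<^sup>2 = 1" using z xy by (simp add: n1 complex_norm)
    have "cmod (1 - Complex x y) < 1" using z xy by (simp add: dist_norm n1 e1)
    then have "(1 - x)\<^sup>2 + y\<^sup>2 < 1"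
      by (simp add: cmod_def)
    then have x: "x > 1/2" using c by (simp add: power2_eq_square algebra_simps)
    have "x\<^sup>2 \<le> 1\<^sup>2" using c zero_le_power2[of y] unfolding one_power2 by linarith
    then have "x \<le> 1" by (rule power2_le_imp_le) simp
    then have p: "(2 * x - 1) * (1 - x) \<ge> 0" using x by simp
    have y2: "y * y = 1 - x * x" using c by (simp add: power2_eq_square)
    have "(cmod (1 + (Complex x y - 1)\<^sup>2))\<^sup>2 = (1 + (x - 1) * (x - 1) - y * y)\<^sup>2 + 4 * (x - 1)\<^sup>2 * (y * y)"
      unfolding cmod_power2 by (simp add: power2_eq_square algebra_simps)
    also have "\<dots> = 1 - 4 * ((2 * x - 1) * (1 - x))"
      unfolding y2 by (simp add: power2_eq_square algebra_simps)
    also have "\<dots> \<le> 1\<^sup>2" using p by simp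
    finally have "cmod (1 + (Complex x y - 1)\<^sup>2) \<le> 1" by (simp add: power2_le_imp_le)
    then show "\<exists>w. has_boundary_value F \<zeta> w \<and> norm w \<le> norm (\<Phi> \<zeta>)"
      using b xy by (intro exI[of _ "F \<zeta>"]) (simp add: n1 F_def \<Phi>_def)
  qed
  show "(\<lambda>z. norm (F z - \<Phi> z)) \<in> o[at e within ball 0 1](\<lambda>z. norm (z - e) ^ (2 * 0 + 1))"
  proof (rule landau_o.smallI)
    fix c :: real assume c: "c > 0"
    have "\<forall>\<^sub>F z in at e within ball 0 1. dist z e < c"
      using c by (auto simp: eventually_at intro!: exI[of _ c])
    then show "\<forall>\<^sub>F z in at e within ball 0 1.
        norm (norm (F z - \<Phi> z)) \<le> c * norm (norm (z - e) ^ (2 * 0 + 1))"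
    proof eventually_elim
      case (elim z)
      have "norm (F z - \<Phi> z) = cmod (z $ 1 - 1) * cmod (z $ 1 - 1)"
        by (simp add: n1 F_def \<Phi>_def power2_eq_square norm_mult)
      also have "\<dots> \<le> c * cmod (z $ 1 - 1)"
        using elim by (intro mult_right_mono) (auto simp: dist_norm n1 e1)
      finally show ?case by (simp add: n1 e1)
    qed
  qed
  show "\<not> (\<forall>z\<in>ball 0 1. F z = \<Phi> z)"
    by (auto simp: F_def \<Phi>_def vec_eq_iff intro!: bexI[of _ 0])
qed

end

theory Submission
  imports Defs "HOL-Complex_Analysis.Conformal_Mappings"
begin

text \<open>
  Complex lines through \<open>e = axis k 1\<close> that are almost tangent to the sphere meet the ball in small
  discs with \<open>e\<close> on their boundary circles. In dimension at least two such discs exist and their union is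
  a nonempty open set, so by the identity theorem it suffices to prove \<open>F = \<Phi>\<close> on each of
  them (\<open>eq_on_tangent_disc\<close>).

  On such a disc the problem is one about a bounded holomorphic map \<open>f\<close> and a polynomial map \<open>P\<close> of
  degree at most \<open>s\<close> with \<open>|f| \<le> |P|\<close> on the unit circle and \<open>f - P = o(|z - 1| ^ (2 s + 1))\<close> at
  \<open>1\<close> (\<open>boundary_uniqueness_disc\<close>). On the circle \<open>Re \<langle>P - f, P\<rangle> \<ge> 0\<close>, where \<open>\<langle>\<cdot>,\<cdot>\<rangle>\<close> is the Hermitian
  product. Because \<open>cnj z = 1 / z\<close> there, \<open>z ^ s \<langle>P - f, P\<rangle>\<close> is the boundary value of
  a holomorphic function \<open>G\<close>; and because \<open>(1 - z)\<^sup>2 = - z |1 - z|\<^sup>2\<close> there, \<open>z G / (1 - z) ^ (2 s + 2)\<close> equals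
  \<open>\<langle>P - f, P\<rangle> / |1 - z| ^ (2 s + 2)\<close> up to sign. So up to sign it is holomorphic in the disc, has
  nonnegative real part on the circle, vanishes at \<open>0\<close>, and is \<open>o(1 / |1 - z|)\<close> at \<open>1\<close>. The mean value property,
  applied on the circle indented at \<open>1\<close>, forces its real part to vanish on the circle, and
  \<open>|P - f|\<^sup>2 \<le> 2 Re \<langle>P - f, P\<rangle>\<close> then gives \<open>f = P\<close> there, hence in the disc. The exponent \<open>2 s + 1\<close>
  is what makes the indentation negligible.

  Two points concern boundary values. The asymptotics at \<open>e\<close> imply that \<open>F\<close> is bounded near \<open>e\<close>, which the
  existence of radial limits alone does not. And the radii of the ball are not radii of the small discs;
  the boundary values enter through the dilations \<open>F (r z)\<close>, for which Cauchy's theorem is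
  available on the closed discs and passes to the limit by dominated convergence.
\<close>

section \<open>Contour integrals over an indented circle\<close>

lemma contour_integral_dominated_convergence:
  assumes int: "\<And>n. f n contour_integrable_on \<gamma>"
    and bound: "\<And>n z. z \<in> path_image \<gamma> \<Longrightarrow> norm (f n z) \<le> M"
    and speed: "\<And>t. t \<in> {0..1} \<Longrightarrow> norm (vector_derivative \<gamma> (at t)) \<le> B"
    and lim: "\<And>z. z \<in> path_image \<gamma> \<Longrightarrow> (\<lambda>n. f n z) \<longlonglongrightarrow> g z"
  shows "g contour_integrable_on \<gamma>"
    and "(\<lambda>n. contour_integral \<gamma> (f n)) \<longlonglongrightarrow> contour_integral \<gamma> g"
proof -
  have img: "\<gamma> t \<in> path_image \<gamma>" if "t \<in> {0..1}" for t
    using that by (simp add: path_image_def)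
  have le: "norm (f n (\<gamma> t) * vector_derivative \<gamma> (at t)) \<le> M * B" if "t \<in> {0..1}" for n t
  proof -
    have "0 \<le> M" using bound[OF img[OF that], of n] norm_ge_zero order_trans by blast
    then show ?thesis
      unfolding norm_mult using bound[OF img[OF that]] speed[OF that] by (intro mult_mono) auto
  qed
  have lim': "(\<lambda>n. f n (\<gamma> t) * vector_derivative \<gamma> (at t)) \<longlonglongrightarrow> g (\<gamma> t) * vector_derivative \<gamma> (at t)"
    if "t \<in> {0..1}" for t
    by (intro tendsto_intros lim img that)
  have c: "(\<lambda>t. M * B) integrable_on {0..1::real}" by auto
  note dc = dominated_convergence[OF int[unfolded contour_integrable_on] c le lim']
  show "g contour_integrable_on \<gamma>"
    unfolding contour_integrable_on by (rule dc(1))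
  show "(\<lambda>n. contour_integral \<gamma> (f n)) \<longlonglongrightarrow> contour_integral \<gamma> g"
    using dc(2) by (simp add: contour_integral_integral)
qed

lemma arc_integral_dominated_convergence:
  assumes cont: "\<And>n. continuous_on (path_image (part_circlepath c r a b)) (f n)"
    and bound: "\<And>n z. z \<in> path_image (part_circlepath c r a b) \<Longrightarrow> norm (f n z) \<le> M"
    and lim: "\<And>z. z \<in> path_image (part_circlepath c r a b) \<Longrightarrow> (\<lambda>n. f n z) \<longlonglongrightarrow> g z"
  shows "g contour_integrable_on part_circlepath c r a b"
    and "(\<lambda>n. contour_integral (part_circlepath c r a b) (f n))
           \<longlonglongrightarrow> contour_integral (part_circlepath c r a b) g"
proof -
  have sp: "norm (vector_derivative (part_circlepath c r a b) (at t)) \<le> \<bar>r * (b - a)\<bar>" for t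
    by (simp add: vector_derivative_part_circlepath norm_mult abs_mult flip: of_real_diff)
  note * = contour_integral_dominated_convergence[OF contour_integrable_continuous_part_circlepath[OF cont]
      bound sp lim]
  show "g contour_integrable_on part_circlepath c r a b"
    by (rule *(1))
  show "(\<lambda>n. contour_integral (part_circlepath c r a b) (f n))
           \<longlonglongrightarrow> contour_integral (part_circlepath c r a b) g"
    by (rule *(2))
qed

lemma cis_neq_1: "cis t \<noteq> 1" if "0 < t" "t < 2 * pi"
proof -
  have "sin (t / 2) > 0" using that by (intro sin_gt_zero) auto
  then have "cos t \<noteq> 1" using cos_double_sin[of "t / 2"] by simp
  then show ?thesis by (metis cis.simps(1) one_complex.simps(1))
qed

text \<open>
  The circle \<open>|z| = 1\<close> is indented at \<open>1\<close> by the arc of radius \<open>\<tau>\<close> about \<open>1\<close> that lies in the closed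
  disc; the two circles meet at \<open>cis \<theta>\<close> and \<open>cis (2 \<pi> - \<theta>)\<close> exactly when \<open>\<tau> = 2 sin (\<theta> / 2)\<close>. The
  indented circle avoids the ray \<open>[1, \<infinity>)\<close>, and a larger disc slit along this ray is starlike,
  so Cauchy's theorem applies there in spite of the pole at \<open>1\<close>.
\<close>
lemma cauchy_indented_circle:
  assumes f: "f holomorphic_on ball 0 R" and R: "R > 1"
    and \<theta>: "0 < \<theta>" "\<theta> < pi" and \<tau>: "\<tau> = 2 * sin (\<theta> / 2)"
  defines "A \<equiv> part_circlepath 0 1 \<theta> (2 * pi - \<theta>)"
    and "B \<equiv> part_circlepath 1 \<tau> (3 * pi / 2 - \<theta> / 2) (pi / 2 + \<theta> / 2)"
  shows "\<tau> > 0"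
    and "path_image A \<subseteq> sphere 0 1 - {1}" and "path_image B \<subseteq> cball 0 1 \<inter> sphere 1 \<tau>"
    and "continuous_on (path_image A) (\<lambda>z. f z / (1 - z) ^ N)"
    and "continuous_on (path_image B) (\<lambda>z. f z / (1 - z) ^ N)"
    and "contour_integral A (\<lambda>z. f z / (1 - z) ^ N) + contour_integral B (\<lambda>z. f z / (1 - z) ^ N) = 0"
proof -
  show \<tau>0: "\<tau> > 0" using \<theta> unfolding \<tau> by (simp add: sin_gt_zero)
  show A: "path_image A \<subseteq> sphere 0 1 - {1}"
  proof -
    have "cis x \<noteq> 1" if "\<theta> \<le> x" "x \<le> 2 * pi - \<theta>" for x
      using that \<theta> by (intro cis_neq_1) auto
    then show ?thesis using \<theta>
      by (auto simp: A_def path_image_part_circlepath cis_conv_exp)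
  qed
  show B: "path_image B \<subseteq> cball 0 1 \<inter> sphere 1 \<tau>"
  proof -
    have "path_image B = path_image (part_circlepath 1 \<tau> (pi / 2 + \<theta> / 2) (3 * pi / 2 - \<theta> / 2))"
      unfolding B_def by (metis path_image_reversepath reversepath_part_circlepath)
    also have "\<dots> \<subseteq> cball 0 1 \<inter> sphere 1 \<tau>"
    proof
      fix z assume "z \<in> path_image (part_circlepath 1 \<tau> (pi / 2 + \<theta> / 2) (3 * pi / 2 - \<theta> / 2))"
      then obtain x where x: "pi / 2 + \<theta> / 2 \<le> x" "x \<le> 3 * pi / 2 - \<theta> / 2" "z = 1 + \<tau> * cis x"
        using \<theta> by (auto simp: path_image_part_circlepath cis_conv_exp)
      have "cos (x - pi) \<ge> cos (pi / 2 - \<theta> / 2)"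
      proof (cases "x \<ge> pi")
        case True
        then show ?thesis using x \<theta> by (intro cos_monotone_0_pi_le) auto
      next
        case False
        then have "cos (pi - x) \<ge> cos (pi / 2 - \<theta> / 2)"
          using x \<theta> by (intro cos_monotone_0_pi_le) auto
        then show ?thesis using cos_minus[of "pi - x"] by simp
      qed
      then have cx: "2 * cos x \<le> - \<tau>" by (simp add: \<tau> cos_diff)
      have "(cmod z)\<^sup>2 = 1 + \<tau> * (2 * cos x + \<tau>)"
      proof -
        have "(cmod z)\<^sup>2 = (1 + \<tau> * cos x)\<^sup>2 + (\<tau> * sin x)\<^sup>2"
          by (simp add: x cmod_power2)
        also have "\<dots> = 1 + \<tau> * (2 * cos x + \<tau> * ((sin x)\<^sup>2 + (cos x)\<^sup>2))"
          by algebra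
        finally show ?thesis by simp
      qed
      also have "\<dots> \<le> 1" using cx \<tau>0 by (simp add: mult_nonneg_nonpos)
      finally have "cmod z \<le> 1" by (simp add: power2_le_imp_le abs_square_le_1)
      moreover have "dist 1 z = \<tau>" using \<tau>0 by (simp add: x dist_norm norm_mult)
      ultimately show "z \<in> cball 0 1 \<inter> sphere 1 \<tau>" by simp
    qed
    finally show ?thesis .
  qed
  define L where "L = {z. Re z \<ge> 1 \<and> Im z = 0}"
  define S where "S = ball 0 R - L"
  have "closed L" unfolding L_def
    by (intro closed_Collect_conj closed_Collect_le closed_Collect_eq continuous_intros)
  then have S: "open S" by (auto simp: S_def)
  have star: "starlike S"
    unfolding starlike_def
  proof (intro bexI[of _ 0] ballI subsetI)
    fix z w assume z: "z \<in> S" and w: "w \<in> closed_segment 0 z"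
    then obtain u where u: "0 \<le> u" "u \<le> 1" "w = u *\<^sub>R z" by (auto simp: in_segment)
    have "cmod w \<le> cmod z" using u mult_right_mono[of u 1 "cmod z"] by simp
    moreover have "w \<notin> L"
    proof
      assume "w \<in> L"
      then have h: "u * Re z \<ge> 1" "u * Im z = 0" using u by (auto simp: L_def)
      then have "u > 0" using u by (cases "u = 0") auto
      moreover have "Re z > 0" using h(1) u(1) by (smt (verit) mult_nonneg_nonpos)
      then have "u * Re z \<le> 1 * Re z" using u by (intro mult_right_mono) auto
      ultimately have "z \<in> L" using h by (auto simp: L_def)
      then show False using z by (simp add: S_def)
    qed
    ultimately show "w \<in> S" using z by (simp add: S_def)
  qed (use R in \<open>auto simp: S_def L_def\<close>)
  have sub: "z \<in> S" if "cmod z \<le> 1" "z \<noteq> 1" for z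
  proof -
    have "z = 1" if "Re z \<ge> 1" "Im z = 0"
    proof -
      have "Re z \<le> 1" using complex_Re_le_cmod[of z] \<open>cmod z \<le> 1\<close> by simp
      then show ?thesis using that by (simp add: complex_eq_iff)
    qed
    then show ?thesis using that R by (auto simp: S_def L_def)
  qed
  have hol: "(\<lambda>z. f z / (1 - z) ^ N) holomorphic_on S"
    by (intro holomorphic_intros holomorphic_on_subset[OF f]) (auto simp: S_def L_def)
  have AS: "path_image A \<subseteq> S" using A by (intro subsetI sub) (auto simp: subset_iff)
  have BS: "path_image B \<subseteq> S" using B sub \<tau>0 by fastforce
  show cA: "continuous_on (path_image A) (\<lambda>z. f z / (1 - z) ^ N)"
    using holomorphic_on_imp_continuous_on[OF hol] AS continuous_on_subset by blast
  show cB: "continuous_on (path_image B) (\<lambda>z. f z / (1 - z) ^ N)"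
    using holomorphic_on_imp_continuous_on[OF hol] BS continuous_on_subset by blast
  have vA: "valid_path A" and vB: "valid_path B" by (simp_all add: A_def B_def)
  \<comment> \<open>The end points of the two arcs agree.\<close>
  have half: "1 + \<tau> * cis (pi / 2 + \<theta> / 2) = cis \<theta>"
  proof -
    have "sin (\<theta> / 2) * sin (\<theta> / 2) * 2 = 1 - cos \<theta>" "sin (\<theta> / 2) * cos (\<theta> / 2) * 2 = sin \<theta>"
      using cos_double_sin[of "\<theta> / 2"] sin_double[of "\<theta> / 2"] by (auto simp: power2_eq_square)
    then show ?thesis by (simp add: complex_eq_iff \<tau> cos_add sin_add)
  qed
  have p: "sin (pi * 3 / 2) = -1" "cos (pi * 3 / 2) = 0"
    using sin_periodic_pi[of "pi/2"] cos_periodic_pi[of "pi/2"] by (simp_all add: field_simps)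
  have half': "1 + \<tau> * cis (3 * pi / 2 - \<theta> / 2) = cis (2 * pi - \<theta>)"
    using half p by (simp add: complex_eq_iff cos_add sin_add sin_diff cos_diff mult.commute)
  have "((\<lambda>z. f z / (1 - z) ^ N) has_contour_integral 0) (A +++ B)"
  proof (rule Cauchy_theorem_starlike_simple[OF S star hol])
    show "valid_path (A +++ B)"
      using vA vB half' by (intro valid_path_join) (simp_all add: A_def B_def cis_conv_exp mult.commute)
    show "path_image (A +++ B) \<subseteq> S" using AS BS path_image_join_subset by blast
    show "pathfinish (A +++ B) = pathstart (A +++ B)"
      using half by (simp add: A_def B_def cis_conv_exp mult.commute)
  qed
  then have "contour_integral (A +++ B) (\<lambda>z. f z / (1 - z) ^ N) = 0"
    by (rule contour_integral_unique)
  then show "contour_integral A (\<lambda>z. f z / (1 - z) ^ N) + contour_integral B (\<lambda>z. f z / (1 - z) ^ N) = 0"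
    using vA vB contour_integrable_continuous_part_circlepath cA cB
    by (simp add: A_def B_def)
qed

text \<open>
  A boundary function \<open>G\<close> that is only a bounded pointwise limit of functions holomorphic across the
  circle still satisfies Cauchy's theorem on the indented circle. If \<open>|G|\<close> is at most
  \<open>c * \<tau> ^ N\<close> on the indentation, where \<open>|1 - z| = \<tau>\<close>, the indentation contributes at most its length
  times \<open>c / \<tau>\<close>. This is at most \<open>c * pi\<close> for every \<open>\<theta>\<close>, and the same bound holds for the
  integral over the large arc.
\<close>
lemma singular_arc_integral_bound:
  fixes G :: "complex \<Rightarrow> complex"
  assumes hol: "\<And>n. \<exists>R>1. g n holomorphic_on ball 0 R"
    and bd: "\<And>n z. cmod z \<le> 1 \<Longrightarrow> cmod (g n z) \<le> M"
    and lim: "\<And>z. cmod z \<le> 1 \<Longrightarrow> (\<lambda>n. g n z) \<longlonglongrightarrow> G z"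
    and \<theta>: "0 < \<theta>" "\<theta> < pi" and \<tau>: "\<tau> = 2 * sin (\<theta> / 2)"
    and G: "\<And>z. cmod z \<le> 1 \<Longrightarrow> cmod (z - 1) = \<tau> \<Longrightarrow> cmod (G z) \<le> c * \<tau> ^ N"
  obtains I where "((\<lambda>t. G (cis t) / (1 - cis t) ^ Suc N * \<i> * cis t) has_integral I) {\<theta>..2 * pi - \<theta>}"
    and "cmod I \<le> c * pi"
proof -
  define A where "A = part_circlepath 0 1 \<theta> (2 * pi - \<theta>)"
  define B where "B = part_circlepath 1 \<tau> (3 * pi / 2 - \<theta> / 2) (pi / 2 + \<theta> / 2)"
  have loc: "\<exists>R>1. g n holomorphic_on ball 0 R" for n using hol by blast
  define R where "R n = (SOME R. R > 1 \<and> g n holomorphic_on ball 0 R)" for n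
  have R: "R n > 1" "g n holomorphic_on ball 0 (R n)" for n
    using someI_ex[OF loc[of n]] by (auto simp: R_def)
  note cic = cauchy_indented_circle[OF R(2) R(1) \<theta> \<tau>, folded A_def B_def]
  have \<tau>0: "\<tau> > 0" by (rule cic(1))
  have A: "path_image A \<subseteq> sphere 0 1 - {1}" and B: "path_image B \<subseteq> cball 0 1 \<inter> sphere 1 \<tau>"
    by (rule cic)+
  have far: "\<exists>d>0. \<forall>z\<in>path_image P. d \<le> cmod (1 - z)" if "path P" "1 \<notin> path_image P" for P
  proof (intro exI conjI ballI)
    show "0 < infdist 1 (path_image P)"
      using that by (simp add: compact_imp_closed compact_path_image infdist_pos_not_in_closed)
    show "infdist 1 (path_image P) \<le> cmod (1 - z)" if "z \<in> path_image P" for z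
      using infdist_le[OF that, of 1] by (simp add: dist_norm)
  qed
  have M0: "M \<ge> 0" using order_trans[OF norm_ge_zero bd[of 0]] by simp
  have bound: "\<exists>M'. \<forall>n. \<forall>z\<in>path_image P. cmod (g n z / (1 - z) ^ Suc N) \<le> M'"
    if P: "path P" "1 \<notin> path_image P" "path_image P \<subseteq> cball 0 1" for P
  proof -
    obtain d where d: "d > 0" "\<And>z. z \<in> path_image P \<Longrightarrow> d \<le> cmod (1 - z)" using far P by blast
    have "cmod (g n z / (1 - z) ^ Suc N) \<le> M / d ^ Suc N" if "z \<in> path_image P" for n z
      unfolding norm_divide norm_power using d that bd P M0
      by (intro frac_le power_mono zero_less_power) (auto simp: subset_iff)
    then show ?thesis by blast
  qed
  have pA: "path A" "1 \<notin> path_image A" "path_image A \<subseteq> cball 0 1"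
    using A by (auto simp: A_def)
  have pB: "path B" "1 \<notin> path_image B" "path_image B \<subseteq> cball 0 1"
    using B \<tau>0 by (auto simp: B_def)
  obtain MA where MA: "\<And>n z. z \<in> path_image A \<Longrightarrow> cmod (g n z / (1 - z) ^ Suc N) \<le> MA"
    using bound[OF pA] by blast
  obtain MB where MB: "\<And>n z. z \<in> path_image B \<Longrightarrow> cmod (g n z / (1 - z) ^ Suc N) \<le> MB"
    using bound[OF pB] by blast
  have l: "(\<lambda>n. g n z / (1 - z) ^ Suc N) \<longlonglongrightarrow> G z / (1 - z) ^ Suc N"
    if "cmod z \<le> 1" "z \<noteq> 1" for z
    using that by (intro tendsto_intros lim) auto
  have lA: "(\<lambda>n. g n z / (1 - z) ^ Suc N) \<longlonglongrightarrow> G z / (1 - z) ^ Suc N" if "z \<in> path_image A" for z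
    using that pA by (intro l) auto
  have lB: "(\<lambda>n. g n z / (1 - z) ^ Suc N) \<longlonglongrightarrow> G z / (1 - z) ^ Suc N" if "z \<in> path_image B" for z
    using that pB by (intro l) auto
  note dA = arc_integral_dominated_convergence[OF cic(4)[unfolded A_def] MA[unfolded A_def]
      lA[unfolded A_def], folded A_def]
  note dB = arc_integral_dominated_convergence[OF cic(5)[unfolded B_def] MB[unfolded B_def]
      lB[unfolded B_def], folded B_def]
  let ?K = "\<lambda>z. G z / (1 - z) ^ Suc N"
  have "(\<lambda>n. contour_integral A (\<lambda>z. g n z / (1 - z) ^ Suc N)
           + contour_integral B (\<lambda>z. g n z / (1 - z) ^ Suc N))
        \<longlonglongrightarrow> contour_integral A ?K + contour_integral B ?K"
    by (intro tendsto_add dA(2) dB(2))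
  then have sum: "contour_integral A ?K + contour_integral B ?K = 0"
    unfolding cic(6) by (simp add: LIMSEQ_const_iff)
  have c0: "c \<ge> 0"
  proof -
    obtain z where "z \<in> path_image B" by (metis path_image_nonempty ex_in_conv)
    then have "cmod z \<le> 1" "cmod (z - 1) = \<tau>" using B by (auto simp: dist_norm norm_minus_commute)
    then have "0 \<le> c * \<tau> ^ N" using G norm_ge_zero order_trans by blast
    then show ?thesis using zero_less_power[OF \<tau>0, of N] by (simp add: zero_le_mult_iff)
  qed
  have "cmod (contour_integral B ?K) \<le> c / \<tau> * \<tau> * \<bar>(pi / 2 + \<theta> / 2) - (3 * pi / 2 - \<theta> / 2)\<bar>"
    unfolding B_def
  proof (rule contour_integral_bound_part_circlepath)
    fix z assume "z \<in> path_image (part_circlepath 1 \<tau> (3 * pi / 2 - \<theta> / 2) (pi / 2 + \<theta> / 2))"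
    then have "z \<in> path_image B" by (simp only: B_def)
    then have z: "cmod z \<le> 1" "cmod (z - 1) = \<tau>" "cmod (1 - z) = \<tau>"
      using B by (auto simp: dist_norm norm_minus_commute)
    have "cmod (?K z) = cmod (G z) / \<tau> ^ Suc N" by (simp add: norm_divide norm_power norm_mult z)
    also have "\<dots> \<le> c * \<tau> ^ N / \<tau> ^ Suc N" using G z \<tau>0 by (intro divide_right_mono) auto
    finally show "cmod (?K z) \<le> c / \<tau>" using \<tau>0 by (simp add: field_simps)
  qed (use dB(1) c0 \<tau>0 in \<open>auto simp: B_def\<close>)
  also have "\<dots> = c * (pi - \<theta>)" using \<tau>0 \<theta> by (simp add: field_simps)
  also have "\<dots> \<le> c * pi" using c0 \<theta> by (intro mult_left_mono) auto
  finally have "cmod (contour_integral A ?K) \<le> c * pi"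
    using sum by (metis add_eq_0_iff norm_minus_cancel)
  moreover have "(?K has_contour_integral contour_integral A ?K) A"
    by (rule has_contour_integral_integral[OF dA(1)])
  then have "((\<lambda>t. G (cis t) / (1 - cis t) ^ Suc N * \<i> * cis t) has_integral contour_integral A ?K)
      {\<theta>..2 * pi - \<theta>}"
    using \<theta> unfolding A_def by (subst (asm) has_contour_integral_part_circlepath_iff) auto
  ultimately show ?thesis using that by blast
qed

section \<open>A uniqueness theorem at a boundary point of the disc\<close>

lemma poly_eq_sum_le:
  fixes p :: "'a::comm_semiring_1 poly"
  assumes "degree p \<le> s"
  shows "poly p z = (\<Sum>i\<le>s. coeff p i * z ^ i)"
  unfolding poly_altdef using assms
  by (intro sum.mono_neutral_left) (auto simp: coeff_eq_0)

text \<open>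
  On the unit circle \<open>cnj z = 1 / z\<close>, so the conjugate of a polynomial of degree at most \<open>s\<close> becomes a
  polynomial after multiplication by \<open>z ^ s\<close>. This turns the Hermitian product with a polynomial map
  into a holomorphic function, at the price of a factor \<open>z ^ s\<close>.
\<close>
lemma reflected_polynomial:
  assumes "degree p \<le> s"
  shows "\<exists>q. \<forall>z. cmod z = 1 \<longrightarrow> poly q z = z ^ s * cnj (poly p z)"
proof (intro exI allI impI)
  fix z :: complex assume z: "cmod z = 1"
  have "z ^ (s - i) = z ^ s * cnj z ^ i" if "i \<le> s" for i
  proof -
    have "z ^ s * cnj z ^ i = z ^ (s - i) * (z * cnj z) ^ i"
      using that by (simp add: power_mult_distrib flip: power_add)
    then show ?thesis by (simp add: complex_norm_square[symmetric] z)
  qed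
  then show "poly (\<Sum>i\<le>s. monom (cnj (coeff p i)) (s - i)) z = z ^ s * cnj (poly p z)"
    by (simp add: poly_eq_sum_le[OF assms] poly_sum poly_monom sum_distrib_left mult_ac)
qed

text \<open>
  On the unit circle \<open>(1 - z)\<^sup>2 = - z |1 - z|\<^sup>2\<close>. Division by \<open>(1 - z) ^ (2 * s + 2)\<close> therefore removes
  the factor \<open>z ^ s\<close> of the reflected polynomial and the factor \<open>z\<close> from \<open>dz = i z dt\<close>, and leaves a
  positive weight.
\<close>
lemma circle_quotient:
  assumes "cmod z = 1" "z \<noteq> 1"
  shows "z ^ s * a / (1 - z) ^ (2 * s + 2) * z = (- 1) ^ Suc s * (a / (cmod (1 - z)) ^ (2 * s + 2))"
proof -
  have z: "z * cnj z = 1" using assms by (simp add: complex_norm_square[symmetric])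
  then have z0: "z \<noteq> 0" by auto
  have "of_real ((cmod (1 - z))\<^sup>2) = (1 - z) * (1 - cnj z)"
    by (metis complex_norm_square complex_cnj_diff complex_cnj_one)
  then have "(1 - z)\<^sup>2 = - (z * of_real ((cmod (1 - z))\<^sup>2))"
    using z by algebra
  then have "(1 - z) ^ (2 * Suc s) = (- 1) ^ Suc s * (z ^ Suc s * of_real (cmod (1 - z) ^ (2 * Suc s)))"
    unfolding power_mult by (simp add: power_mult_distrib power_minus[of "_ * _"])
  then have e: "(1 - z) ^ (2 * s + 2) = (- 1) ^ Suc s * (z ^ Suc s * of_real (cmod (1 - z) ^ (2 * s + 2)))"
    by simp
  have sq: "(- 1) ^ Suc s * (- 1) ^ Suc s = (1::complex)" by (simp flip: power_mult_distrib)
  have "z ^ s * a / (1 - z) ^ (2 * s + 2) * z = z ^ Suc s * a / ((- 1) ^ Suc s * (z ^ Suc s * of_real (cmod (1 - z) ^ (2 * s + 2))))"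
    unfolding e by simp
  also have "\<dots> = (1 / (- 1) ^ Suc s) * (a / of_real (cmod (1 - z) ^ (2 * s + 2)))"
    using z0 by simp
  also have "1 / (- 1) ^ Suc s = ((- 1) ^ Suc s :: complex)" using sq by (simp add: field_simps)
  finally show ?thesis by simp
qed

text \<open>
  The one-variable core. Let \<open>\<langle>\<cdot>,\<cdot>\<rangle>\<close> be the Hermitian product. The function \<open>z ^ s * \<langle>P - f, P\<rangle>\<close> on the circle
  is the boundary value of a holomorphic function \<open>G\<close> that vanishes at \<open>1\<close> to order more than
  \<open>2 * s + 1\<close>. By \<open>circle_quotient\<close>, \<open>G / (1 - z) ^ (2 * s + 2) dz\<close> equals \<open>\<langle>P - f, P\<rangle> / |1 - z| ^ (2 * s + 2) dt\<close>
  on the circle up to a constant factor of modulus one; the function \<open>G / (1 - z) ^ (2 * s + 2)\<close> has no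
  pole inside the disc, and its integral over a small indentation at \<open>1\<close> tends to zero. Hence the
  integral of \<open>Re \<langle>P - f, P\<rangle> / |1 - z| ^ (2 * s + 2)\<close> over the circle without a small arc around \<open>1\<close>
  tends to zero as the arc shrinks. But \<open>|f| \<le> |P|\<close> gives
  \<open>|P - f|\<^sup>2 = |P|\<^sup>2 + |f|\<^sup>2 - 2 Re \<langle>f, P\<rangle> \<le> 2 Re \<langle>P - f, P\<rangle>\<close>, so \<open>f = P\<close> almost everywhere on the circle.

  The functions \<open>h n\<close> encode in which sense \<open>f\<close> has boundary values: in the application they are the
  restrictions of dilated maps \<open>F (r z)\<close> to a disc, and no limit along radii of that disc is needed.
\<close>
lemma boundary_uniqueness_disc:
  fixes f :: "complex \<Rightarrow> complex ^ 'm" and h :: "nat \<Rightarrow> complex \<Rightarrow> complex ^ 'm"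
    and p :: "'m \<Rightarrow> complex poly"
  defines "P \<equiv> \<lambda>z. \<chi> j. poly (p j) z"
  assumes deg: "\<And>j. degree (p j) \<le> s"
    and hol: "\<And>n. \<exists>R>1. \<forall>j. (\<lambda>z. h n z $ j) holomorphic_on ball 0 R"
    and bd: "\<And>n z. cmod z \<le> 1 \<Longrightarrow> norm (h n z) \<le> M"
    and lim: "\<And>z. cmod z \<le> 1 \<Longrightarrow> (\<lambda>n. h n z) \<longlonglongrightarrow> f z"
    and le: "\<And>z. cmod z = 1 \<Longrightarrow> norm (f z) \<le> norm (P z)"
    and asym: "\<And>\<eta>. \<eta> > 0 \<Longrightarrow> \<exists>d>0. \<forall>z. cmod z \<le> 1 \<and> cmod (z - 1) < d \<longrightarrow>
                 norm (f z - P z) \<le> \<eta> * cmod (z - 1) ^ (2 * s + 1)"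
    and z: "cmod z < 1"
  shows "f z = P z"
proof -
  obtain q where q: "\<And>j z. cmod z = 1 \<Longrightarrow> poly (q j) z = z ^ s * cnj (poly (p j) z)"
    using reflected_polynomial[OF deg] by metis
  have cb: "\<exists>B. \<forall>z. cmod z \<le> 1 \<longrightarrow> norm (g z) \<le> B" if g: "continuous_on (cball 0 1) g"
    for g :: "complex \<Rightarrow> 'c::real_normed_vector"
  proof -
    obtain B where "\<forall>w\<in>g ` cball 0 1. norm w \<le> B"
      using compact_imp_bounded[OF compact_continuous_image[OF g compact_cball]]
      by (auto simp: bounded_iff)
    then show ?thesis by (intro exI[of _ B]) auto
  qed
  have cP: "continuous_on X P" for X
    unfolding P_def by (intro continuous_intros)
  obtain B where B: "\<And>z. cmod z \<le> 1 \<Longrightarrow> norm (P z) \<le> B" using cb[OF cP] by blast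
  have "\<exists>C. \<forall>z. cmod z \<le> 1 \<longrightarrow> norm (poly (q j) z) \<le> C" for j
    by (intro cb continuous_intros)
  then obtain C where C: "\<And>j z. cmod z \<le> 1 \<Longrightarrow> cmod (poly (q j) z) \<le> C j" by metis
  have C0: "C j \<ge> 0" for j using order_trans[OF norm_ge_zero C[of 0 j]] by simp
  define Q where "Q = (\<Sum>j\<in>UNIV. C j)"
  have fM: "norm (f z) \<le> M" if "cmod z \<le> 1" for z
    using LIMSEQ_le_const2[OF tendsto_norm[OF lim[OF that]]] bd[OF that] by blast
  have G_le: "cmod (\<Sum>j\<in>UNIV. poly (q j) z * (P z - x) $ j) \<le> Q * norm (x - P z)" if "cmod z \<le> 1" for z x
  proof -
    have "cmod (\<Sum>j\<in>UNIV. poly (q j) z * (P z - x) $ j) \<le> (\<Sum>j\<in>UNIV. C j * norm (P z - x))"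
    proof (rule sum_norm_le)
      fix j
      show "cmod (poly (q j) z * (P z - x) $ j) \<le> C j * norm (P z - x)"
        unfolding norm_mult using C[OF that, of j] C0[of j]
        by (intro mult_mono Finite_Cartesian_Product.norm_nth_le) (auto simp del: vector_minus_component)
    qed
    then show ?thesis by (simp add: Q_def sum_distrib_right norm_minus_commute)
  qed
  have Q0: "Q \<ge> 0" unfolding Q_def by (intro sum_nonneg C0)
  define G where "G z = (\<Sum>j\<in>UNIV. poly (q j) z * (P z - f z) $ j)" for z
  define D where "D t = (norm (P (cis t) - f (cis t)))\<^sup>2" for t
  define U where "U t = P (cis t) \<bullet> (P (cis t) - f (cis t))" for t
  have DU: "D t \<le> 2 * U t" for t
    using power_mono[OF le[of "cis t"], of 2]
    by (simp add: D_def U_def power2_norm_eq_inner inner_diff inner_commute)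
  have D0: "D t \<ge> 0" for t by (simp add: D_def)
  define E where "E = (B + M)\<^sup>2"
  have normD: "norm (P z - x) \<le> B + M" if "norm x \<le> M" "cmod z \<le> 1" for x z
    using norm_triangle_ineq4[of "P z" x] that B[of z] by linarith
  have DE: "D t \<le> E" for t
    unfolding D_def E_def using fM[of "cis t"] by (intro power_mono normD) auto
  have ch: "continuous_on (cball 0 1) (h n)" for n
  proof -
    obtain R where R: "R > 1" "\<And>j. (\<lambda>z. h n z $ j) holomorphic_on ball 0 R" using hol by blast
    have "continuous_on (cball 0 1) (\<lambda>z. h n z $ j)" for j
      by (rule continuous_on_subset[OF holomorphic_on_imp_continuous_on[OF R(2)]]) (use R in auto)
    then have "continuous_on (cball 0 1) (\<lambda>z. \<chi> j. h n z $ j)"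
      by (rule continuous_on_vec_lambda)
    then show ?thesis by (simp only: vec_nth_inverse)
  qed
  have chc: "continuous_on X (\<lambda>t. h n (cis t))" for X n
    by (rule continuous_on_compose2[OF ch]) (auto intro!: continuous_intros)
  have cPc: "continuous_on X (\<lambda>t. P (cis t))" for X
    by (rule continuous_on_compose2[OF cP[of UNIV]]) (auto intro!: continuous_intros)
  have Dint: "D integrable_on {0..2 * pi}"
    unfolding D_def
  proof (rule dominated_convergence(1)[where f = "\<lambda>n t. (norm (P (cis t) - h n (cis t)))\<^sup>2" and h = "\<lambda>t. E"])
    show "(\<lambda>t. (norm (P (cis t) - h n (cis t)))\<^sup>2) integrable_on {0..2 * pi}" for n
      by (intro integrable_continuous_real continuous_intros chc cPc)
    show "norm ((norm (P (cis t) - h n (cis t)))\<^sup>2) \<le> E" for n t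
      unfolding E_def using bd[of "cis t" n] by (simp add: power_mono normD)
    show "(\<lambda>n. (norm (P (cis t) - h n (cis t)))\<^sup>2) \<longlonglongrightarrow> (norm (P (cis t) - f (cis t)))\<^sup>2" for t
      by (intro tendsto_intros lim) simp
  qed auto
  \<comment> \<open>The mean square of \<open>P - f\<close> away from \<open>1\<close> is controlled by the size of \<open>f - P\<close> near \<open>1\<close>.\<close>
  have key: "integral {\<theta>..2 * pi - \<theta>} D \<le> 2 * 2 ^ (2 * s + 2) * (Q * \<eta> * pi)"
    if \<theta>: "0 < \<theta>" "\<theta> < pi" and \<eta>: "\<And>z. cmod z \<le> 1 \<Longrightarrow> cmod (z - 1) = 2 * sin (\<theta> / 2) \<Longrightarrow>
                 norm (f z - P z) \<le> \<eta> * cmod (z - 1) ^ (2 * s + 1)" for \<theta> \<eta>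
  proof -
    have "\<exists>I. ((\<lambda>t. G (cis t) / (1 - cis t) ^ Suc (2 * s + 1) * \<i> * cis t) has_integral I) {\<theta>..2 * pi - \<theta>}
               \<and> cmod I \<le> Q * \<eta> * pi"
    proof (rule singular_arc_integral_bound[where G = G and c = "Q * \<eta>" and N = "2 * s + 1"
          and g = "\<lambda>n z. \<Sum>j\<in>UNIV. poly (q j) z * (P z - h n z) $ j", OF _ _ _ \<theta> refl])
      fix n
      obtain R where R: "R > 1" "\<And>j. (\<lambda>z. h n z $ j) holomorphic_on ball 0 R" using hol by blast
      have "(\<lambda>z. \<Sum>j\<in>UNIV. poly (q j) z * (P z - h n z) $ j) holomorphic_on ball 0 R"
        unfolding P_def by (auto intro!: holomorphic_intros R)
      then show "\<exists>R>1. (\<lambda>z. \<Sum>j\<in>UNIV. poly (q j) z * (P z - h n z) $ j) holomorphic_on ball 0 R"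
        using R by blast
    next
      fix n and z :: complex assume "cmod z \<le> 1"
      then have "cmod (\<Sum>j\<in>UNIV. poly (q j) z * (P z - h n z) $ j) \<le> Q * norm (P z - h n z)"
        using G_le[of z "h n z"] by (simp add: norm_minus_commute)
      also have "\<dots> \<le> Q * (B + M)" using Q0 bd[of z n] \<open>cmod z \<le> 1\<close> by (intro mult_left_mono normD)
      finally show "cmod (\<Sum>j\<in>UNIV. poly (q j) z * (P z - h n z) $ j) \<le> Q * (B + M)" .
    next
      fix z :: complex assume "cmod z \<le> 1"
      then show "(\<lambda>n. \<Sum>j\<in>UNIV. poly (q j) z * (P z - h n z) $ j) \<longlonglongrightarrow> G z"
        unfolding G_def by (intro tendsto_intros lim)
    next
      fix z :: complex assume z: "cmod z \<le> 1" "cmod (z - 1) = 2 * sin (\<theta> / 2)"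
      have "cmod (G z) \<le> Q * norm (f z - P z)" unfolding G_def by (rule G_le[OF z(1)])
      also have "\<dots> \<le> Q * (\<eta> * cmod (z - 1) ^ (2 * s + 1))" by (intro mult_left_mono \<eta> z Q0)
      finally show "cmod (G z) \<le> Q * \<eta> * (2 * sin (\<theta> / 2)) ^ (2 * s + 1)" by (simp add: z mult_ac)
    qed blast
    then obtain I where I: "((\<lambda>t. G (cis t) / (1 - cis t) ^ Suc (2 * s + 1) * \<i> * cis t) has_integral I) {\<theta>..2 * pi - \<theta>}"
      and I_le: "cmod I \<le> Q * \<eta> * pi" by blast
    \<comment> \<open>Undoes the constant factor from \<open>circle_quotient\<close> and the \<open>\<i>\<close> from \<open>dz = \<i> z dt\<close>.\<close>
    define W where "W = (\<lambda>x. Re ((- 1) ^ Suc s * (- \<i>) * x))"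
    have blW: "bounded_linear W"
      unfolding W_def by (rule bounded_linear_compose[OF bounded_linear_Re bounded_linear_mult_right])
    have cis1: "cis t \<noteq> 1" if "t \<in> {\<theta>..2 * pi - \<theta>}" for t
      using that \<theta> by (intro cis_neq_1) auto
    have Wval: "W (G (cis t) / (1 - cis t) ^ Suc (2 * s + 1) * \<i> * cis t) = U t / cmod (1 - cis t) ^ (2 * s + 2)"
      if "t \<in> {\<theta>..2 * pi - \<theta>}" for t
    proof -
      define a where "a = (\<Sum>j\<in>UNIV. cnj (P (cis t) $ j) * (P (cis t) - f (cis t)) $ j)"
      have "G (cis t) = cis t ^ s * a"
        unfolding G_def a_def sum_distrib_left by (intro sum.cong) (simp_all add: q P_def)
      then have quot: "G (cis t) / (1 - cis t) ^ Suc (2 * s + 1) * cis t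
           = (- 1) ^ Suc s * (a / of_real (cmod (1 - cis t) ^ (2 * s + 2)))"
        using circle_quotient[OF _ cis1[OF that], of s a] by simp
      have ac: "x * \<i> * y = \<i> * (x * y)" "u * (- \<i>) * (\<i> * (u * v)) = (u * u) * v" for x y u v :: complex
        by (simp_all add: mult_ac)
      have "W (G (cis t) / (1 - cis t) ^ Suc (2 * s + 1) * \<i> * cis t)
          = Re (((- 1) ^ Suc s * (- 1) ^ Suc s) * (a / of_real ((cmod (1 - cis t)) ^ (2 * s + 2))))"
        unfolding W_def ac(1) quot ac(2) ..
      also have "((- 1) ^ Suc s * (- 1) ^ Suc s) = (1::complex)" by (simp flip: power_mult_distrib)
      also have "Re (1 * (a / of_real ((cmod (1 - cis t)) ^ (2 * s + 2)))) = Re a / cmod (1 - cis t) ^ (2 * s + 2)"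
        by (simp only: mult_1 Re_divide_of_real)
      also have "Re a = U t"
        unfolding a_def U_def inner_vec_def by (simp add: inner_complex_def)
      finally show ?thesis .
    qed
    have WI: "((\<lambda>t. U t / cmod (1 - cis t) ^ (2 * s + 2)) has_integral W I) {\<theta>..2 * pi - \<theta>}"
      using has_integral_linear[OF I blW] Wval by (subst has_integral_cong[OF Wval[symmetric]]) (auto simp: o_def)
    have WI_le: "W I \<le> Q * \<eta> * pi"
    proof -
      have "W I \<le> cmod ((- 1) ^ Suc s * (- \<i>) * I)" unfolding W_def by (rule complex_Re_le_cmod)
      also have "\<dots> = cmod I" by (simp add: norm_mult norm_power)
      finally show ?thesis using I_le by linarith
    qed
    have Dle: "D t \<le> 2 * 2 ^ (2 * s + 2) * (U t / cmod (1 - cis t) ^ (2 * s + 2))" if "t \<in> {\<theta>..2 * pi - \<theta>}" for t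
    proof -
      have "cmod (1 - cis t) \<le> 2" using norm_triangle_ineq4[of 1 "cis t"] by simp
      then have "cmod (1 - cis t) ^ (2 * s + 2) \<le> 2 ^ (2 * s + 2)" by (intro power_mono) auto
      moreover have "cmod (1 - cis t) ^ (2 * s + 2) > 0" using cis1[OF that] by simp
      moreover have "U t \<ge> 0" using DU[of t] D0[of t] by linarith
      ultimately have "U t \<le> 2 ^ (2 * s + 2) * (U t / cmod (1 - cis t) ^ (2 * s + 2))"
        by (simp only: pos_le_divide_eq times_divide_eq_right mult.commute[of _ "U t"] mult_left_mono)
      then show ?thesis using DU[of t] by linarith
    qed
    have "integral {\<theta>..2 * pi - \<theta>} D \<le> 2 * 2 ^ (2 * s + 2) * W I"
    proof (rule has_integral_le)
      show "(D has_integral integral {\<theta>..2 * pi - \<theta>} D) {\<theta>..2 * pi - \<theta>}"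
        by (rule integrable_integral[OF integrable_on_subinterval[OF Dint]]) (use \<theta> in auto)
      show "((\<lambda>t. 2 * 2 ^ (2 * s + 2) * (U t / cmod (1 - cis t) ^ (2 * s + 2))) has_integral 2 * 2 ^ (2 * s + 2) * W I)
          {\<theta>..2 * pi - \<theta>}"
        by (rule has_integral_mult_right[OF WI])
    qed (use Dle in auto)
    also have "\<dots> \<le> 2 * 2 ^ (2 * s + 2) * (Q * \<eta> * pi)" using WI_le by (intro mult_left_mono) auto
    finally show ?thesis .
  qed
  \<comment> \<open>The two short arcs next to \<open>1\<close> contribute little because \<open>D\<close> is bounded by \<open>E\<close>.\<close>
  have "integral {0..2 * pi} D \<le> 0"
  proof (rule field_le_epsilon)
    fix e :: real assume e: "e > 0"
    define X where "X = 2 * 2 ^ (2 * s + 2) * ((Q + 1) * pi)"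
    have X: "X > 0" unfolding X_def using Q0 by (intro mult_pos_pos) auto
    define \<eta> where "\<eta> = e / 2 / X"
    have \<eta>0: "\<eta> > 0" unfolding \<eta>_def using e X by (intro divide_pos_pos) auto
    obtain d where d: "d > 0" "\<And>z. cmod z \<le> 1 \<Longrightarrow> cmod (z - 1) < d \<Longrightarrow>
        norm (f z - P z) \<le> \<eta> * cmod (z - 1) ^ (2 * s + 1)" using asym[OF \<eta>0] by blast
    define \<theta> where "\<theta> = min (min 1 (d / 2)) (e / 4 / (E + 1))"
    have E0: "E \<ge> 0" by (simp add: E_def)
    have \<theta>: "0 < \<theta>" "\<theta> \<le> 1" "\<theta> < d" "\<theta> \<le> e / 4 / (E + 1)"
      using d(1) e E0 by (auto simp: \<theta>_def)
    have \<theta>pi: "\<theta> < pi" using \<theta>(2) pi_gt3 by linarith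
    have small: "2 * sin (\<theta> / 2) < d" using sin_x_le_x[of "\<theta> / 2"] \<theta> by simp
    have i: "D integrable_on {a..b}" if "0 \<le> a" "b \<le> 2 * pi" for a b
      by (rule integrable_on_subinterval[OF Dint]) (use that in auto)
    have "integral {0..2 * pi} D = integral {0..\<theta>} D + integral {\<theta>..2 * pi} D"
      using \<theta> \<theta>pi by (intro Henstock_Kurzweil_Integration.integral_combine[symmetric] i) auto
    also have "integral {\<theta>..2 * pi} D = integral {\<theta>..2 * pi - \<theta>} D + integral {2 * pi - \<theta>..2 * pi} D"
      using \<theta> \<theta>pi by (intro Henstock_Kurzweil_Integration.integral_combine[symmetric] i) auto
    finally have split: "integral {0..2 * pi} D = integral {0..\<theta>} D + integral {\<theta>..2 * pi - \<theta>} D + integral {2 * pi - \<theta>..2 * pi} D"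
      by simp
    have short: "integral {a..b} D \<le> E * (b - a)" if "0 \<le> a" "a \<le> b" "b \<le> 2 * pi" for a b
      using integral_le[OF i[of a b] integrable_const_ivl, of E] DE that by (simp add: mult.commute)
    have "E * \<theta> \<le> (E + 1) * (e / 4 / (E + 1))" using \<theta> E0 by (intro mult_mono) auto
    also have "\<dots> = e / 4"
    proof -
      have "(E + 1) * (y / (E + 1)) = y" for y using E0 by simp
      then show ?thesis .
    qed
    finally have E\<theta>: "E * \<theta> \<le> e / 4" .
    have "integral {\<theta>..2 * pi - \<theta>} D \<le> 2 * 2 ^ (2 * s + 2) * (Q * \<eta> * pi)"
      using small by (intro key \<theta>(1) \<theta>pi d(2)) auto
    also have "\<dots> \<le> 2 * 2 ^ (2 * s + 2) * ((Q + 1) * \<eta> * pi)"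
      using \<eta>0 by (intro mult_left_mono mult_right_mono) auto
    also have "\<dots> = X * \<eta>" by (simp add: X_def mult_ac)
    also have "\<dots> = e / 2" unfolding \<eta>_def using X by simp
    finally show "integral {0..2 * pi} D \<le> 0 + e"
      using split short[of 0 \<theta>] short[of "2 * pi - \<theta>" "2 * pi"] E\<theta> \<theta> \<theta>pi by simp
  qed
  then have intD: "integral {0..2 * pi} D = 0"
    using integral_nonneg[OF Dint D0] by simp
  \<comment> \<open>Cauchy's formula for \<open>f - P\<close> holds in the limit, and the integral in it vanishes.\<close>
  have "f z $ j = P z $ j" for j
  proof -
    let ?F = "\<lambda>w. (f w $ j - P w $ j) / (w - z)"
    let ?H = "\<lambda>n w. (h n w $ j - P w $ j) / (w - z)"
    define r where "r = 1 - cmod z"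
    have r: "r > 0" using z by (simp add: r_def)
    have r_le: "r \<le> cmod (w - z)" if "cmod w = 1" for w
      using norm_triangle_ineq2[of w z] that by (simp add: r_def)
    have circ: "cmod w = 1" if "w \<in> path_image (part_circlepath 0 1 0 (2 * pi))" for w
      using that path_image_part_circlepath_subset'[of 1 0 0 "2 * pi"] by auto
    have cauchy: "(?H n has_contour_integral 2 * of_real pi * \<i> * (h n z $ j - P z $ j)) (circlepath 0 1)" for n
    proof (rule Cauchy_integral_circlepath_simple)
      obtain R where R: "R > 1" "\<And>j. (\<lambda>z. h n z $ j) holomorphic_on ball 0 R" using hol by blast
      have "(\<lambda>w. h n w $ j) holomorphic_on cball 0 1"
        by (rule holomorphic_on_subset[OF R(2)]) (use R(1) in auto)
      then show "(\<lambda>w. h n w $ j - P w $ j) holomorphic_on cball 0 1"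
        unfolding P_def by (auto intro!: holomorphic_intros)
    qed (use z in simp)
    have ci: "continuous_on (path_image (part_circlepath 0 1 0 (2 * pi))) (?H n)" for n
    proof (intro continuous_intros)
      show "continuous_on (path_image (part_circlepath 0 1 0 (2 * pi))) (h n)"
        by (rule continuous_on_subset[OF ch]) (use circ in auto)
      show "continuous_on (path_image (part_circlepath 0 1 0 (2 * pi))) P" by (rule cP)
    qed (use circ z in auto)
    have b: "cmod (?H n w) \<le> (B + M) / r" if "w \<in> path_image (part_circlepath 0 1 0 (2 * pi))" for n w
    proof -
      have "cmod (h n w $ j - P w $ j) \<le> norm (P w - h n w)"
        using Finite_Cartesian_Product.norm_nth_le[of "h n w - P w" j] by (simp add: norm_minus_commute)
      also have "\<dots> \<le> B + M" using bd[of w n] circ[OF that] by (intro normD) auto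
      finally have num: "cmod (h n w $ j - P w $ j) \<le> B + M" .
      show ?thesis unfolding norm_divide
        using num order_trans[OF norm_ge_zero num] r r_le[OF circ[OF that]] by (intro frac_le) auto
    qed
    have l: "(\<lambda>n. ?H n w) \<longlonglongrightarrow> ?F w" if "w \<in> path_image (part_circlepath 0 1 0 (2 * pi))" for w
      using circ[OF that] z by (intro tendsto_intros lim) auto
    have dc: "?F contour_integrable_on part_circlepath 0 1 0 (2 * pi)"
      "(\<lambda>n. contour_integral (part_circlepath 0 1 0 (2 * pi)) (?H n))
         \<longlonglongrightarrow> contour_integral (part_circlepath 0 1 0 (2 * pi)) ?F"
      by (rule arc_integral_dominated_convergence[OF ci b l]; assumption)+
    have "(\<lambda>n. 2 * of_real pi * \<i> * (h n z $ j - P z $ j)) \<longlonglongrightarrow> contour_integral (circlepath 0 1) ?F"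
      using dc(2) contour_integral_unique[OF cauchy] by (simp add: circlepath_def)
    moreover have "(\<lambda>n. 2 * of_real pi * \<i> * (h n z $ j - P z $ j)) \<longlonglongrightarrow> 2 * of_real pi * \<i> * (f z $ j - P z $ j)"
      using z by (intro tendsto_intros lim) auto
    ultimately have ceq: "contour_integral (circlepath 0 1) ?F = 2 * of_real pi * \<i> * (f z $ j - P z $ j)"
      by (rule LIMSEQ_unique)
    let ?k = "\<lambda>t. ?F (0 + of_real 1 * cis t) * of_real 1 * \<i> * cis t"
    have iF: "?k integrable_on {0..2 * pi}"
      using dc(1) by (subst (asm) contour_integrable_part_circlepath_iff) auto
    have eq: "contour_integral (circlepath 0 1) ?F = integral {0..2 * pi} ?k"
      unfolding circlepath_def by (subst contour_integral_part_circlepath_eq) auto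
    \<comment> \<open>From \<open>x / r \<le> l x\<^sup>2 + 1 / (4 l r\<^sup>2)\<close>; then let \<open>l\<close> tend to infinity.\<close>
    have bnd: "cmod (integral {0..2 * pi} ?k) \<le> 2 * pi / r\<^sup>2 / (4 * l)" if l: "l > 0" for l
    proof -
      have "cmod (integral {0..2 * pi} ?k) \<le> integral {0..2 * pi} (\<lambda>t. l * D t + 1 / r\<^sup>2 / (4 * l))"
      proof (rule integral_norm_bound_integral[OF iF])
        show "(\<lambda>t. l * D t + 1 / r\<^sup>2 / (4 * l)) integrable_on {0..2 * pi}"
          by (intro integrable_add integrable_on_cmult_left[OF Dint, simplified] integrable_const_ivl)
        fix t
        have "cmod (f (cis t) $ j - P (cis t) $ j) \<le> norm (P (cis t) - f (cis t))"
          using Finite_Cartesian_Product.norm_nth_le[of "f (cis t) - P (cis t)" j] by (simp add: norm_minus_commute)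
        then have "cmod (?k t) \<le> norm (P (cis t) - f (cis t)) / r"
          using r r_le[of "cis t"] by (simp add: norm_mult norm_divide frac_le)
        also have "\<dots> \<le> l * D t + 1 / r\<^sup>2 / (4 * l)"
        proof -
          have "0 \<le> (2 * l * norm (P (cis t) - f (cis t)) - 1 / r)\<^sup>2 / (4 * l)" using l by simp
          also have "\<dots> = l * D t + 1 / r\<^sup>2 / (4 * l) - norm (P (cis t) - f (cis t)) / r"
            using l r by (simp add: D_def power2_eq_square field_simps)
          finally show ?thesis by simp
        qed
        finally show "cmod (?k t) \<le> l * D t + 1 / r\<^sup>2 / (4 * l)" .
      qed
      also have "\<dots> = l * integral {0..2 * pi} D + 2 * pi * (1 / r\<^sup>2 / (4 * l))"
        using Dint by (subst integral_add) (auto intro: integrable_on_cmult_left[OF Dint, simplified])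
      finally show ?thesis by (simp add: intD)
    qed
    have "cmod (integral {0..2 * pi} ?k) \<le> 0"
    proof (rule field_le_epsilon)
      fix e :: real assume e: "e > 0"
      have "cmod (integral {0..2 * pi} ?k) \<le> 2 * pi / r\<^sup>2 / (4 * (2 * pi / r\<^sup>2 / e))"
        using e r by (intro bnd) simp
      also have "\<dots> = e / 4" using r e by simp
      finally show "cmod (integral {0..2 * pi} ?k) \<le> 0 + e" using e by simp
    qed
    then show ?thesis using ceq eq by simp
  qed
  then show ?thesis by (simp add: vec_eq_iff)
qed

section \<open>Holomorphic and polynomial maps on complex lines\<close>

lemma norm_vector_scalar_mult: "norm (c *s (v :: complex ^ 'n)) = cmod c * norm v"
  by (simp add: norm_vec_def L2_set_right_distrib norm_mult)

lemma bounded_linear_vector_scalar_mult_left: "bounded_linear (\<lambda>c. c *s (b :: complex ^ 'n))"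
proof -
  have "linear (\<lambda>c. c *s b)"
    by (intro linearI) (simp_all add: vec_eq_iff algebra_simps)
  then show ?thesis by (simp add: linear_conv_bounded_linear)
qed

lemma holomorphic_map_on_line:
  assumes F: "F holomorphic_map_on S" and T: "\<And>\<zeta>. \<zeta> \<in> T \<Longrightarrow> a + \<zeta> *s b \<in> S"
  shows "(\<lambda>\<zeta>. F (a + \<zeta> *s b) $ j) holomorphic_on T"
  unfolding holomorphic_on_def
proof
  fix \<zeta> assume "\<zeta> \<in> T"
  then obtain F' where F': "(F has_derivative F') (at (a + \<zeta> *s b))" "\<And>c v. F' (c *s v) = c *s F' v"
    using F T unfolding holomorphic_map_on_def by blast
  have "((\<lambda>\<zeta>. a + \<zeta> *s b) has_derivative (\<lambda>h. h *s b)) (at \<zeta> within T)"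
    using has_derivative_add[OF has_derivative_const[of a] bounded_linear_imp_has_derivative[OF bounded_linear_vector_scalar_mult_left]] by simp
  from has_derivative_compose[OF this F'(1)]
  have "((\<lambda>\<zeta>. F (a + \<zeta> *s b) $ j) has_derivative (\<lambda>h. F' (h *s b) $ j)) (at \<zeta> within T)"
    by (rule bounded_linear.has_derivative[OF bounded_linear_vec_nth])
  moreover have "(\<lambda>h. F' (h *s b) $ j) = (*) (F' b $ j)" by (simp add: F'(2) fun_eq_iff)
  ultimately show "(\<lambda>\<zeta>. F (a + \<zeta> *s b) $ j) field_differentiable at \<zeta> within T"
    by (auto simp: field_differentiable_def has_field_derivative_def)
qed

lemma holomorphic_map_on_isCont:
  "F holomorphic_map_on S \<Longrightarrow> z \<in> S \<Longrightarrow> isCont F z"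
  unfolding holomorphic_map_on_def using has_derivative_continuous by blast

lemma continuous_on_line: "continuous_on X (\<lambda>\<zeta>. a + \<zeta> *s (b :: complex ^ 'n))"
  by (intro continuous_on_add continuous_on_const linear_continuous_on
      bounded_linear_vector_scalar_mult_left)

text \<open>
  The identity theorem in several variables, for convex domains: join \<open>u\<close> to \<open>z\<close> by a complex line.
  The part of the line inside \<open>S\<close> is convex, hence connected, and the one-variable identity theorem
  applies to it.
\<close>
lemma holomorphic_map_on_eqI:
  fixes F G :: "complex ^ 'n \<Rightarrow> complex ^ 'm"
  assumes F: "F holomorphic_map_on S" and G: "G holomorphic_map_on S"
    and S: "open S" "convex S" and U: "open U" "U \<subseteq> S" "u \<in> U"
    and eq: "\<And>z. z \<in> U \<Longrightarrow> F z = G z" and z: "z \<in> S"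
  shows "F z = G z"
proof -
  define l where "l = (\<lambda>t::complex. u + t *s (z - u))"
  have l: "continuous_on UNIV l" unfolding l_def by (rule continuous_on_line)
  have opn: "open (l -` X)" if "open X" for X
    using continuous_on_open_vimage[of UNIV l] l that by simp
  have "convex (l -` S)"
  proof (rule convexI)
    fix x y and a b :: real
    assume h: "x \<in> l -` S" "y \<in> l -` S" "0 \<le> a" "0 \<le> b" "a + b = 1"
    have "l (a *\<^sub>R x + b *\<^sub>R y) = (a + b) *\<^sub>R u + (a *\<^sub>R x + b *\<^sub>R y) *s (z - u)"
      by (simp add: l_def h)
    also have "\<dots> = a *\<^sub>R l x + b *\<^sub>R l y"
      by (simp add: l_def vec_eq_iff algebra_simps)
    also have "\<dots> \<in> S" using h S(2) by (intro convexD) auto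
    finally show "a *\<^sub>R x + b *\<^sub>R y \<in> l -` S" by simp
  qed
  then have conn: "connected (l -` S)" by (rule convex_connected)
  have "F (l 1) $ j - G (l 1) $ j = 0" for j
  proof (rule analytic_continuation[of "\<lambda>t. F (l t) $ j - G (l t) $ j" "l -` S" "l -` U" 0])
    show "(\<lambda>t. F (l t) $ j - G (l t) $ j) holomorphic_on l -` S"
      unfolding l_def by (intro holomorphic_intros holomorphic_map_on_line[OF F] holomorphic_map_on_line[OF G]) auto
    have "(0::complex) \<in> l -` U" using U by (simp add: l_def)
    then show "0 islimpt l -` U"
      using opn[OF U(1)] by (intro interior_limit_point) (simp add: interior_open)
  qed (use opn conn S U eq z in \<open>auto simp: l_def\<close>)
  then show ?thesis by (simp add: l_def vec_eq_iff)
qed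

lemma poly_total_degree_le_line:
  assumes "poly_total_degree_le s f"
  shows "\<exists>p. degree p \<le> s \<and> (\<forall>\<zeta>. f (a + \<zeta> *s b) = poly p \<zeta>)"
proof -
  obtain c where c: "\<And>z. f z = (\<Sum>\<alpha> | (\<Sum>i\<in>UNIV. \<alpha> i) \<le> s. c \<alpha> * (\<Prod>i\<in>UNIV. (z $ i) ^ \<alpha> i))"
    using assms unfolding poly_total_degree_le_def by blast
  define p where "p = (\<Sum>\<alpha> | (\<Sum>i\<in>UNIV. \<alpha> i) \<le> s. smult (c \<alpha>) (\<Prod>i\<in>UNIV. [:a $ i, b $ i:] ^ \<alpha> i))"
  have "degree p \<le> s"
    unfolding p_def
  proof (rule degree_sum_le[OF finite_multi_indices])
    fix \<alpha> :: "'a \<Rightarrow> nat" assume \<alpha>: "\<alpha> \<in> {\<alpha>. (\<Sum>i\<in>UNIV. \<alpha> i) \<le> s}"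
    have "degree (\<Prod>i\<in>UNIV. [:a $ i, b $ i:] ^ \<alpha> i) \<le> (\<Sum>i\<in>UNIV. degree ([:a $ i, b $ i:] ^ \<alpha> i))"
      using degree_prod_sum_le[of UNIV "\<lambda>i. [:a $ i, b $ i:] ^ \<alpha> i"] by (simp add: o_def)
    also have "\<dots> \<le> (\<Sum>i\<in>UNIV. \<alpha> i)"
    proof (rule sum_mono)
      fix i
      have "degree ([:a $ i, b $ i:] ^ \<alpha> i) \<le> degree [:a $ i, b $ i:] * \<alpha> i" by (rule degree_power_le)
      also have "\<dots> \<le> 1 * \<alpha> i" by (intro mult_right_mono) auto
      finally show "degree ([:a $ i, b $ i:] ^ \<alpha> i) \<le> \<alpha> i" by simp
    qed
    finally show "degree (smult (c \<alpha>) (\<Prod>i\<in>UNIV. [:a $ i, b $ i:] ^ \<alpha> i)) \<le> s"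
      using \<alpha> order_trans[OF degree_smult_le] by fastforce
  qed
  moreover have "f (a + \<zeta> *s b) = poly p \<zeta>" for \<zeta>
    unfolding c p_def by (simp add: poly_sum poly_prod)
  ultimately show ?thesis by blast
qed

lemma poly_total_degree_le_continuous_on:
  assumes "poly_total_degree_le s f" shows "continuous_on X f"
proof -
  obtain c where c: "\<And>z. f z = (\<Sum>\<alpha> | (\<Sum>i\<in>UNIV. \<alpha> i) \<le> s. c \<alpha> * (\<Prod>i\<in>UNIV. (z $ i) ^ \<alpha> i))"
    using assms unfolding poly_total_degree_le_def by blast
  show ?thesis unfolding c by (intro continuous_intros)
qed

section \<open>Small discs through the boundary point\<close>

text \<open>
  For \<open>q \<noteq> 0\<close> the condition on \<open>q\<close> means that the disc with centre \<open>axis k 1 - q\<close>, spanned by \<open>q\<close>, is the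
  intersection of the unit ball with a complex line through \<open>axis k 1\<close>: the parameter circle
  \<open>|\<zeta>| = 1\<close> is mapped into the sphere, with \<open>\<zeta> = 1\<close> going to \<open>axis k 1\<close>. The disc has radius \<open>norm q\<close>, so
  it is small when the line is almost tangent to the sphere.
\<close>
lemma norm_tangent_disc:
  fixes q :: "complex ^ 'n"
  assumes "q $ k = of_real ((norm q)\<^sup>2)"
  shows "(norm (axis k 1 - q + \<zeta> *s q))\<^sup>2 = 1 + (norm q)\<^sup>2 * ((cmod \<zeta>)\<^sup>2 - 1)"
proof -
  define v where "v = (\<zeta> - 1) *s q"
  have eq: "axis k 1 - q + \<zeta> *s q = axis k 1 + v" by (simp add: v_def vec_eq_iff algebra_simps)
  have "(norm (axis k 1 - q + \<zeta> *s q))\<^sup>2 = 1 + 2 * (axis k 1 \<bullet> v) + (norm v)\<^sup>2"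
    unfolding eq by (simp add: power2_norm_eq_inner inner_add inner_commute inner_axis_axis)
  also have "(norm v)\<^sup>2 = (cmod (\<zeta> - 1))\<^sup>2 * (norm q)\<^sup>2"
    unfolding v_def norm_vector_scalar_mult by (simp add: power_mult_distrib)
  also have "axis k 1 \<bullet> v = (Re \<zeta> - 1) * (norm q)\<^sup>2"
    by (simp add: v_def inner_axis' assms inner_complex_def algebra_simps)
  also have "(cmod (\<zeta> - 1))\<^sup>2 = (cmod \<zeta>)\<^sup>2 - 2 * Re \<zeta> + 1"
    unfolding cmod_power2 by (simp add: power2_eq_square algebra_simps)
  finally show ?thesis by (simp add: algebra_simps)
qed

text \<open>
  For \<open>u = z - axis k 1\<close> the vector \<open>q\<close> must be the multiple of \<open>u\<close> whose \<open>k\<close>-th entry is the square of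
  its norm. Its norm is \<open>|u $ k| / |u|\<close>, which is small where \<open>z\<close> approaches \<open>axis k 1\<close> almost
  tangentially.
\<close>
lemma tangent_disc_through:
  fixes z :: "complex ^ 'n"
  assumes z: "norm z < 1" and near: "cmod (z $ k - 1) < d * norm (z - axis k 1)"
  obtains q \<zeta> where "q \<noteq> 0" "q $ k = of_real ((norm q)\<^sup>2)" "norm q < d" "cmod \<zeta> < 1" "z = axis k 1 - q + \<zeta> *s q"
proof -
  define u where "u = z - axis k 1"
  have uk: "u $ k \<noteq> 0"
    using Finite_Cartesian_Product.norm_nth_le[of z k] z by (auto simp: u_def)
  then have u0: "u \<noteq> 0" by auto
  then have n0: "norm u > 0" by simp
  define q where "q = (cnj (u $ k) / of_real ((norm u)\<^sup>2)) *s u"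
  define \<zeta> where "\<zeta> = 1 + of_real ((norm u)\<^sup>2) / cnj (u $ k)"
  have "cmod (of_real ((norm u)\<^sup>2)) = (norm u)\<^sup>2" by (simp only: norm_of_real abs_power2)
  then have nq: "norm q = cmod (u $ k) / norm u"
    unfolding q_def norm_vector_scalar_mult norm_divide using n0
    by (simp add: power2_eq_square)
  have "q \<noteq> 0" using nq uk n0 by auto
  moreover have qk: "q $ k = of_real ((norm q)\<^sup>2)"
    unfolding nq using complex_norm_square[of "u $ k"]
    by (simp add: q_def power_divide mult.commute)
  moreover have "norm q < d" unfolding nq using near n0 by (simp add: u_def pos_divide_less_eq)
  moreover have zq: "z = axis k 1 - q + \<zeta> *s q"
  proof -
    have "(\<zeta> - 1) * (cnj (u $ k) / of_real ((norm u)\<^sup>2)) = 1" using uk u0 by (simp add: \<zeta>_def)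
    then have "(\<zeta> - 1) *s q = u" unfolding q_def vector_smult_assoc by simp
    moreover have "axis k 1 - q + \<zeta> *s q = axis k 1 + (\<zeta> - 1) *s q" by (simp add: vec_eq_iff algebra_simps)
    ultimately show ?thesis by (simp add: u_def)
  qed
  moreover have "cmod \<zeta> < 1"
  proof -
    have "(norm z)\<^sup>2 < 1" using z by (simp add: abs_square_less_1)
    then have "(norm q)\<^sup>2 * ((cmod \<zeta>)\<^sup>2 - 1) < 0" using norm_tangent_disc[OF qk, of \<zeta>] zq by simp
    then have "(cmod \<zeta>)\<^sup>2 < 1" by (simp add: mult_less_0_iff)
    then show ?thesis by (simp add: abs_square_less_1)
  qed
  ultimately show ?thesis using that by blast
qed

text \<open>
  This is where the dimension matters: in dimension one every point of the disc satisfies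
  \<open>cmod (z $ k - 1) = norm (z - axis k 1)\<close>, and the region is empty for \<open>d \<le> 1\<close>.
\<close>
lemma tangential_region_nonempty:
  fixes k :: "'n::finite"
  assumes dim: "CARD('n) \<ge> 2" and d: "d > 0"
  obtains z :: "complex ^ 'n" where "norm z < 1" "cmod (z $ k - 1) < d * norm (z - axis k 1)"
proof -
  have "\<exists>j. j \<noteq> k"
  proof (rule ccontr)
    assume "\<not> (\<exists>j. j \<noteq> k)"
    then have "(UNIV :: 'n set) = {k}" by auto
    then have "CARD('n) = card {k}" by presburger
    then show False using dim by simp
  qed
  then obtain j where j: "j \<noteq> k" by blast
  \<comment> \<open>The point \<open>(1 - b\<^sup>2, b)\<close> is inside the ball at distance of order \<open>b\<^sup>2\<close> from the complex tangent space \<open>z $ k = 1\<close>.\<close>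
  define b where "b = min (d / 2) (1 / 2)"
  have b: "0 < b" "b < d" "b < 1" using d by (auto simp: b_def)
  define z :: "complex ^ 'n" where "z = axis k (of_real (1 - b\<^sup>2)) + axis j (of_real b)"
  have zk: "z $ k = of_real (1 - b\<^sup>2)" and zj: "z $ j = of_real b"
    using j by (auto simp: z_def axis_def)
  have "(norm z)\<^sup>2 = (1 - b\<^sup>2)\<^sup>2 + b\<^sup>2"
    unfolding z_def power2_norm_eq_inner using j
    by (simp add: inner_add inner_axis_axis inner_complex_def power2_eq_square)
  also have "\<dots> = 1 - b\<^sup>2 * (1 - b\<^sup>2)" by (simp add: power2_eq_square algebra_simps)
  also have "\<dots> < 1" using b by (simp add: abs_square_less_1)
  finally have "norm z < 1" by (simp add: abs_square_less_1)
  moreover have "cmod (z $ k - 1) < d * norm (z - axis k 1)"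
  proof -
    have "cmod (z $ k - 1) = b * b" by (simp add: zk power2_eq_square norm_mult abs_of_pos[OF b(1)])
    also have "\<dots> < d * b" using b by simp
    also have "b = cmod ((z - axis k 1) $ j)" using j zj b by (simp add: axis_def)
    also have "d * cmod ((z - axis k 1) $ j) \<le> d * norm (z - axis k 1)"
      using d by (intro mult_left_mono Finite_Cartesian_Product.norm_nth_le) auto
    finally show ?thesis .
  qed
  ultimately show ?thesis using that by blast
qed

text \<open>
  The closed disc lies in the region where all hypotheses on \<open>F\<close> are available: its radius is less
  than \<open>\<delta> / 2\<close> and its boundary circle is contained in the sphere. The maps \<open>F (r n *\<^sub>R z)\<close> with \<open>r n\<close>
  increasing to \<open>1\<close> are holomorphic beyond the closed disc and converge to \<open>F\<close> inside it and to the
  radial boundary values of \<open>F\<close> on the circle, which is what \<open>boundary_uniqueness_disc\<close> requires.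
\<close>
lemma eq_on_tangent_disc:
  fixes \<Phi> F :: "complex ^ 'n \<Rightarrow> complex ^ 'm" and k :: 'n
  defines "e \<equiv> axis k (1::complex)"
  assumes poly: "\<And>j. poly_total_degree_le s (\<lambda>z. \<Phi> z $ j)"
    and F: "F holomorphic_map_on ball 0 1"
    and bdry: "\<And>\<zeta>. \<zeta> \<in> sphere 0 1 \<Longrightarrow> dist \<zeta> e < \<delta> \<Longrightarrow>
                 \<exists>w. has_boundary_value F \<zeta> w \<and> norm w \<le> norm (\<Phi> \<zeta>)"
    and asym: "\<And>\<eta>. \<eta> > 0 \<Longrightarrow> \<exists>d>0. \<forall>z\<in>ball 0 1. dist z e < d \<longrightarrow>
                 norm (F z - \<Phi> z) \<le> \<eta> * norm (z - e) ^ (2 * s + 1)"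
    and bounded: "\<And>z. z \<in> ball 0 1 \<Longrightarrow> dist z e < \<delta> \<Longrightarrow> norm (F z) \<le> M"
    and q: "q \<noteq> 0" "q $ k = of_real ((norm q)\<^sup>2)" "2 * norm q < \<delta>" "norm q \<le> 1"
    and \<zeta>: "cmod \<zeta> < 1"
  shows "F (e - q + \<zeta> *s q) = \<Phi> (e - q + \<zeta> *s q)"
proof -
  define g where "g = (\<lambda>\<zeta>. e - q + \<zeta> *s q)"
  have g: "(norm (g \<zeta>))\<^sup>2 = 1 + (norm q)\<^sup>2 * ((cmod \<zeta>)\<^sup>2 - 1)" for \<zeta>
    unfolding g_def e_def by (rule norm_tangent_disc[OF q(2)])
  have nq: "norm q > 0" using q by simp
  have g_sphere: "norm (g \<zeta>) = 1" if "cmod \<zeta> = 1" for \<zeta>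
    using g[of \<zeta>] that by (simp add: abs_square_eq_1)
  have g_ball: "norm (g \<zeta>) < 1" if "cmod \<zeta> < 1" for \<zeta>
  proof -
    have "(cmod \<zeta>)\<^sup>2 - 1 < 0" using that by (simp add: abs_square_less_1)
    then have "(norm q)\<^sup>2 * ((cmod \<zeta>)\<^sup>2 - 1) < 0" using nq by (intro mult_pos_neg) auto
    then have "(norm (g \<zeta>))\<^sup>2 < 1" using g[of \<zeta>] by linarith
    then show ?thesis by (simp add: abs_square_less_1)
  qed
  have g_cball: "norm (g \<zeta>) \<le> 1" if "cmod \<zeta> \<le> 1" for \<zeta>
    using g_ball[of \<zeta>] g_sphere[of \<zeta>] that by fastforce
  have ge: "norm (g \<zeta> - e) = cmod (\<zeta> - 1) * norm q" for \<zeta>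
  proof -
    have "g \<zeta> - e = (\<zeta> - 1) *s q" by (simp add: g_def vec_eq_iff algebra_simps)
    then show ?thesis by (simp only: norm_vector_scalar_mult)
  qed
  have ge2: "norm (g \<zeta> - e) \<le> 2 * norm q" if "cmod \<zeta> \<le> 1" for \<zeta>
  proof -
    have "cmod (\<zeta> - 1) \<le> 2" using norm_triangle_ineq4[of \<zeta> 1] that by simp
    then show ?thesis unfolding ge by (intro mult_right_mono) auto
  qed
  \<comment> \<open>The dilations must be so close to the identity that the dilated disc stays within \<open>\<delta>\<close> of \<open>e\<close>.\<close>
  define c where "c = min (1 / 2) ((\<delta> - 2 * norm q) / 2)"
  have c: "c > 0" "c < 1" "2 * norm q + c < \<delta>"
    using q(3) by (auto simp: c_def min_def field_simps)
  define r where "r = (\<lambda>n::nat. 1 - c / real (n + 1))"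
  have r: "0 < r n" "r n < 1" "1 - r n \<le> c" for n
  proof -
    have "c / real (n + 1) \<le> c / 1" using c(1) by (intro divide_left_mono) auto
    moreover have "c / real (n + 1) > 0" using c(1) by simp
    ultimately show "0 < r n" "r n < 1" "1 - r n \<le> c" using c(2) unfolding r_def by linarith+
  qed
  have "r \<longlonglongrightarrow> 1 - 0"
    unfolding r_def
    by (intro tendsto_diff tendsto_const LIMSEQ_ignore_initial_segment[OF lim_const_over_n, of _ 1])
  then have r1: "r \<longlonglongrightarrow> 1" by simp
  then have r_left: "filterlim r (at_left 1) sequentially"
    using r(2) by (simp add: filterlim_at eventually_sequentially less_imp_neq)
  define h where "h = (\<lambda>n \<zeta>. F (r n *\<^sub>R g \<zeta>))"
  have rg: "r n *\<^sub>R g \<zeta> \<in> ball 0 1" "dist (r n *\<^sub>R g \<zeta>) e < \<delta>" if "cmod \<zeta> \<le> 1" for n \<zeta>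
  proof -
    have "r n * norm (g \<zeta>) \<le> r n * 1" using g_cball[OF that] r(1)[of n] by (intro mult_left_mono) auto
    then have "r n * norm (g \<zeta>) < 1" using r(2)[of n] by linarith
    then show "r n *\<^sub>R g \<zeta> \<in> ball 0 1" using r(1)[of n] by simp
    have "r n *\<^sub>R g \<zeta> - e = (g \<zeta> - e) - (1 - r n) *\<^sub>R g \<zeta>" by (simp add: algebra_simps)
    then have "dist (r n *\<^sub>R g \<zeta>) e \<le> norm (g \<zeta> - e) + norm ((1 - r n) *\<^sub>R g \<zeta>)"
      unfolding dist_norm by (metis norm_triangle_ineq4)
    also have "norm ((1 - r n) *\<^sub>R g \<zeta>) \<le> c * 1"
      unfolding norm_scaleR using r[of n] g_cball[OF that] by (intro mult_mono) auto
    finally show "dist (r n *\<^sub>R g \<zeta>) e < \<delta>" using ge2[OF that] c(3) by linarith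
  qed
  define f where "f \<zeta> = (if cmod \<zeta> < 1 then F (g \<zeta>)
      else (SOME w. has_boundary_value F (g \<zeta>) w \<and> norm w \<le> norm (\<Phi> (g \<zeta>))))" for \<zeta>
  have f_circle: "has_boundary_value F (g \<zeta>) (f \<zeta>) \<and> norm (f \<zeta>) \<le> norm (\<Phi> (g \<zeta>))" if "cmod \<zeta> = 1" for \<zeta>
  proof -
    have "dist (g \<zeta>) e < \<delta>" using ge2[of \<zeta>] that q(3) by (simp add: dist_norm)
    then show ?thesis using someI_ex[OF bdry[of "g \<zeta>"]] g_sphere[OF that] that by (simp add: f_def)
  qed
  have rg_lim: "(\<lambda>n. r n *\<^sub>R g \<zeta>) \<longlonglongrightarrow> g \<zeta>" for \<zeta>
    using tendsto_scaleR[OF r1 tendsto_const[of "g \<zeta>"]] by simp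
  have lim: "(\<lambda>n. h n \<zeta>) \<longlonglongrightarrow> f \<zeta>" if "cmod \<zeta> \<le> 1" for \<zeta>
  proof (cases "cmod \<zeta> < 1")
    case True
    then have "isCont F (g \<zeta>)" using F g_ball holomorphic_map_on_isCont by fastforce
    from isCont_tendsto_compose[OF this rg_lim] show ?thesis using True by (simp add: h_def f_def)
  next
    case False
    then have "((\<lambda>t. F (t *\<^sub>R g \<zeta>)) \<longlongrightarrow> f \<zeta>) (at_left 1)"
      using f_circle that by (simp add: has_boundary_value_def)
    from filterlim_compose[OF this r_left] show ?thesis by (simp add: h_def)
  qed
  obtain p where p: "\<And>j. degree (p j) \<le> s" "\<And>j \<zeta>. \<Phi> (g \<zeta>) $ j = poly (p j) \<zeta>"
    using poly_total_degree_le_line[OF poly, of "e - q" q] unfolding g_def by metis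
  have \<Phi>g: "\<Phi> (g \<zeta>) = (\<chi> j. poly (p j) \<zeta>)" for \<zeta> by (simp add: vec_eq_iff p)
  have "continuous_on UNIV (\<lambda>z. \<chi> j. \<Phi> z $ j)"
    by (intro continuous_on_vec_lambda poly_total_degree_le_continuous_on[OF poly])
  then have \<Phi>_cont: "isCont \<Phi> z" for z
    by (simp add: vec_nth_inverse continuous_on_eq_continuous_at)
  have "f \<zeta> = (\<chi> j. poly (p j) \<zeta>)"
  proof (rule boundary_uniqueness_disc[OF p(1), where h = h and M = M])
    fix n
    \<comment> \<open>The radius at which \<open>norm (g \<zeta>) = 1 / r n\<close>.\<close>
    define R where "R = sqrt (1 + ((1 / r n)\<^sup>2 - 1) / (norm q)\<^sup>2)"
    have "1 / r n > 1" using r[of n] by simp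
    then have "(1 / r n)\<^sup>2 > 1" by (simp add: one_less_power)
    then have "R > 1" unfolding R_def using nq by simp
    moreover have "(\<lambda>\<zeta>. F (r n *\<^sub>R (e - q) + \<zeta> *s (r n *\<^sub>R q)) $ j) holomorphic_on ball 0 R" for j
    proof (rule holomorphic_map_on_line[OF F])
      fix \<zeta> :: complex assume "\<zeta> \<in> ball 0 R"
      then have "(cmod \<zeta>)\<^sup>2 < R\<^sup>2" by (simp add: power_strict_mono)
      also have "R\<^sup>2 = 1 + ((1 / r n)\<^sup>2 - 1) / (norm q)\<^sup>2"
        unfolding R_def using \<open>(1 / r n)\<^sup>2 > 1\<close> nq by (intro real_sqrt_pow2) simp
      finally have "(norm q)\<^sup>2 * ((cmod \<zeta>)\<^sup>2 - 1) < (1 / r n)\<^sup>2 - 1"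
        using nq by (simp add: field_simps)
      then have "(norm (g \<zeta>))\<^sup>2 < (1 / r n)\<^sup>2" by (simp add: g)
      then have "norm (g \<zeta>) < 1 / r n" by (rule power2_less_imp_less) (use r(1)[of n] in simp)
      then have "norm (r n *\<^sub>R g \<zeta>) < 1" using r(1)[of n] by (simp add: field_simps)
      also have "r n *\<^sub>R g \<zeta> = r n *\<^sub>R (e - q) + \<zeta> *s (r n *\<^sub>R q)"
        by (simp add: g_def vec_eq_iff algebra_simps)
      finally show "r n *\<^sub>R (e - q) + \<zeta> *s (r n *\<^sub>R q) \<in> ball 0 1" by simp
    qed
    moreover have "r n *\<^sub>R (e - q) + \<zeta> *s (r n *\<^sub>R q) = r n *\<^sub>R g \<zeta>" for \<zeta>
      by (simp add: g_def vec_eq_iff algebra_simps)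
    ultimately show "\<exists>R>1. \<forall>j. (\<lambda>\<zeta>. h n \<zeta> $ j) holomorphic_on ball 0 R"
      unfolding h_def by auto
  next
    fix n and \<zeta> :: complex assume "cmod \<zeta> \<le> 1"
    then show "norm (h n \<zeta>) \<le> M" unfolding h_def by (intro bounded rg)
  next
    fix \<zeta> :: complex assume "cmod \<zeta> = 1"
    then show "norm (f \<zeta>) \<le> norm (\<chi> j. poly (p j) \<zeta>)" using f_circle by (simp add: \<Phi>g)
  next
    fix \<eta> :: real assume \<eta>: "\<eta> > 0"
    then obtain d where d: "d > 0" "\<And>z. z \<in> ball 0 1 \<Longrightarrow> dist z e < d \<Longrightarrow>
        norm (F z - \<Phi> z) \<le> \<eta> * norm (z - e) ^ (2 * s + 1)" using asym by blast
    have "norm (f \<zeta> - (\<chi> j. poly (p j) \<zeta>)) \<le> \<eta> * cmod (\<zeta> - 1) ^ (2 * s + 1)"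
      if "cmod \<zeta> \<le> 1" "cmod (\<zeta> - 1) < d" for \<zeta>
    proof -
      have "norm (g \<zeta> - e) \<le> cmod (\<zeta> - 1) * 1" unfolding ge using q by (intro mult_left_mono) auto
      then have ge1: "norm (g \<zeta> - e) \<le> cmod (\<zeta> - 1)" by simp
      \<comment> \<open>The asymptotic bound in the ball passes to boundary values.\<close>
      have "norm (f \<zeta> - \<Phi> (g \<zeta>)) \<le> \<eta> * norm (g \<zeta> - e) ^ (2 * s + 1)"
      proof (rule tendsto_le[OF trivial_limit_sequentially])
        show "(\<lambda>n. \<eta> * norm (r n *\<^sub>R g \<zeta> - e) ^ (2 * s + 1)) \<longlonglongrightarrow> \<eta> * norm (g \<zeta> - e) ^ (2 * s + 1)"
          by (intro tendsto_intros rg_lim)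
        show "(\<lambda>n. norm (h n \<zeta> - \<Phi> (r n *\<^sub>R g \<zeta>))) \<longlonglongrightarrow> norm (f \<zeta> - \<Phi> (g \<zeta>))"
          by (intro tendsto_intros lim that isCont_tendsto_compose[OF \<Phi>_cont rg_lim])
        have "(\<lambda>n. dist (r n *\<^sub>R g \<zeta>) e) \<longlonglongrightarrow> dist (g \<zeta>) e" by (intro tendsto_intros rg_lim)
        then have "\<forall>\<^sub>F n in sequentially. dist (r n *\<^sub>R g \<zeta>) e < d"
          by (rule order_tendstoD) (use ge1 that in \<open>simp add: dist_norm\<close>)
        then show "\<forall>\<^sub>F n in sequentially. norm (h n \<zeta> - \<Phi> (r n *\<^sub>R g \<zeta>)) \<le> \<eta> * norm (r n *\<^sub>R g \<zeta> - e) ^ (2 * s + 1)"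
          by eventually_elim (unfold h_def, intro d(2) rg that)
      qed
      also have "\<dots> \<le> \<eta> * cmod (\<zeta> - 1) ^ (2 * s + 1)"
        using ge1 \<eta> by (intro mult_left_mono power_mono) auto
      finally show ?thesis by (simp add: \<Phi>g)
    qed
    then show "\<exists>d>0. \<forall>\<zeta>. cmod \<zeta> \<le> 1 \<and> cmod (\<zeta> - 1) < d \<longrightarrow>
        norm (f \<zeta> - (\<chi> j. poly (p j) \<zeta>)) \<le> \<eta> * cmod (\<zeta> - 1) ^ (2 * s + 1)"
      using d(1) by blast
  qed (use lim \<zeta> in auto)
  then have "F (g \<zeta>) = \<Phi> (g \<zeta>)" using \<zeta> by (simp add: f_def \<Phi>g)
  then show ?thesis by (simp only: g_def)
qed

section \<open>The uniqueness theorem\<close>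

theorem theorem1p2:
  fixes \<Phi> F :: "complex ^ 'n \<Rightarrow> complex ^ 'm"
    and k :: 'n and s :: nat and \<epsilon> :: real
  assumes dim: "CARD('n) \<ge> 2"
    and \<Phi>_holo: "\<Phi> holomorphic_map_on ball 0 1"
    and \<Phi>_poly: "\<And>j. poly_total_degree_le s (\<lambda>z. \<Phi> z $ j)"
    and \<Phi>_nz: "\<And>j. \<Phi> (axis k 1) $ j \<noteq> 0"
    and F_holo: "F holomorphic_map_on ball 0 1"
    and eps: "\<epsilon> > 0"
    and bdry: "\<forall>\<zeta> \<in> sphere 0 1 \<inter> ball (axis k 1) \<epsilon>.
                 \<exists>w. has_boundary_value F \<zeta> w \<and> norm w \<le> norm (\<Phi> \<zeta>)"
    and asym: "(\<lambda>z. norm (F z - \<Phi> z))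
                 \<in> o[at (axis k 1) within ball 0 1](\<lambda>z. norm (z - axis k 1) ^ (2 * s + 1))"
  shows "\<forall>z \<in> ball 0 1. F z = \<Phi> z"
proof
  fix z :: "complex ^ 'n" assume z: "z \<in> ball 0 1"
  define e :: "complex ^ 'n" where "e = axis k 1"
  have small: "\<exists>d>0. \<forall>z\<in>ball 0 1. dist z e < d \<longrightarrow>
                 norm (F z - \<Phi> z) \<le> \<eta> * norm (z - e) ^ (2 * s + 1)" if "\<eta> > 0" for \<eta>
  proof -
    have "e \<notin> ball 0 1" by (simp add: e_def)
    then show ?thesis
      using landau_o.smallD[OF asym that] unfolding e_def[symmetric] eventually_at by fastforce
  qed
  \<comment> \<open>Near \<open>e\<close> the asymptotics bound \<open>F\<close>; radial limits alone would not.\<close>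
  obtain d1 where d1: "d1 > 0" "\<And>z. z \<in> ball 0 1 \<Longrightarrow> dist z e < d1 \<Longrightarrow>
      norm (F z - \<Phi> z) \<le> norm (z - e) ^ (2 * s + 1)" using small[of 1] by auto
  define \<delta> where "\<delta> = min (min d1 \<epsilon>) 1"
  have \<delta>: "0 < \<delta>" "\<delta> \<le> d1" "\<delta> \<le> \<epsilon>" "\<delta> \<le> 1" using d1(1) eps by (auto simp: \<delta>_def)
  have "continuous_on (cball 0 1) (\<lambda>z. \<chi> j. \<Phi> z $ j)"
    by (intro continuous_on_vec_lambda poly_total_degree_le_continuous_on[OF \<Phi>_poly])
  then have "bounded (\<Phi> ` cball 0 1)"
    unfolding vec_nth_inverse by (intro compact_imp_bounded compact_continuous_image compact_cball)
  then obtain B where B: "\<And>z. z \<in> cball 0 1 \<Longrightarrow> norm (\<Phi> z) \<le> B"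
    unfolding bounded_iff by blast
  have bounded: "norm (F z) \<le> B + 1" if "z \<in> ball 0 1" "dist z e < \<delta>" for z
  proof -
    have "norm (F z - \<Phi> z) \<le> norm (z - e) ^ (2 * s + 1)" using that \<delta> by (intro d1(2)) auto
    also have "\<dots> \<le> 1" using that \<delta> by (intro power_le_one) (auto simp: dist_norm)
    finally show ?thesis using norm_triangle_sub[of "F z" "\<Phi> z"] B[of z] that by simp
  qed
  \<comment> \<open>The points of the ball on discs through \<open>e\<close> of radius less than \<open>\<delta> / 2\<close>.\<close>
  define U where "U = {z::complex ^ 'n. norm z < 1 \<and> cmod (z $ k - 1) < \<delta> / 2 * norm (z - e)}"
  have "open U" unfolding U_def
    by (intro open_Collect_conj open_Collect_less continuous_intros)
  moreover obtain u where "u \<in> U"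
    using tangential_region_nonempty[OF dim, of "\<delta> / 2" k] \<delta>(1) unfolding U_def e_def by auto
  moreover have "F z = \<Phi> z" if "z \<in> U" for z
  proof -
    from that obtain q \<zeta> where q: "q \<noteq> 0" "q $ k = of_real ((norm q)\<^sup>2)" "norm q < \<delta> / 2"
      and \<zeta>: "cmod \<zeta> < 1" "z = axis k 1 - q + \<zeta> *s q"
      unfolding U_def e_def by (blast elim: tangent_disc_through)
    show ?thesis unfolding \<zeta>(2)
    proof (rule eq_on_tangent_disc[OF \<Phi>_poly F_holo _ small[unfolded e_def] bounded[unfolded e_def] q(1,2) _ _ \<zeta>(1)])
      fix \<xi> :: "complex ^ 'n" assume "\<xi> \<in> sphere 0 1" "dist \<xi> (axis k 1) < \<delta>"
      then show "\<exists>w. has_boundary_value F \<xi> w \<and> norm w \<le> norm (\<Phi> \<xi>)"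
        using bdry \<delta>(3) by (auto simp: dist_commute)
    qed (use q(3) \<delta>(4) in auto)
  qed
  moreover have "U \<subseteq> ball 0 1" by (auto simp: U_def)
  ultimately show "F z = \<Phi> z"
    using holomorphic_map_on_eqI[OF F_holo \<Phi>_holo _ _ _ _ _ _ z, of U u] by simp
qed

end
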